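(* Let $K$ and $L$ be finite groups, let $L$ act on $K$, and let $K\rtimes L$ be the corresponding semidirect product. If $\mathscr H$ is a $(K\rtimes L)$-Frobenius algebra, then the space of $K$-coinvariants $\mathscr H^K$, with the structures induced from $\mathscr H$ (described in the context), is an $L$-Frobenius algebra.
   Context: All groups are finite, all actions are right actions, vector spaces are finite-dimensional over $\mathbb Q$. The action of $l\in L$ on $k\in K$ is $k\mapsto k^l$; $K$ is identified with a normal subgroup of $K\rtimes L$ and $k^l=l^{-1}kl$. For a finite group $\Gamma$, a $\Gamma$-graded $\Gamma$-module is a space $\mathscr H=\bigoplus_{m\in\Gamma}\mathscr H_m$ with a right action $\rho$ of $\Gamma$ such that $\rho(\gamma):\mathscr H_m\to\mathscr H_{\gamma^{-1}m\gamma}$ for all $m,\gamma$. A $\Gamma$-Frobenius algebra is a tuple $((\mathscr H,\rho),\cdot,\mathbf 1,\eta)$ such that: (i) $(\mathscr H,\rho)$ is a $\Gamma$-graded $\Gamma$-module; (ii) $\rho(\gamma):\mathscr H_\gamma\to\mathscr H_\gamma$ is the identity for all $\gamma$; (iii) $\eta$ is a symmetric non-degenerate bilinear form with $\eta(v_{m_1},v_{m_2})$ nonzero only if $m_1m_2=1$ (for $v_{m_i}\in\mathscr H_{m_i}$); (iv) the bilinear product maps $\mathscr H_{m_1}\otimes\mathscr H_{m_2}$ to $\mathscr H_{m_1m_2}$; (v) the product is associative; (vi) $v_{m_1}\cdot v_{m_2}=(\rho(m_1^{-1})v_{m_2})\cdot v_{m_1}$ for $v_{m_i}\in\mathscr H_{m_i}$;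 (vii) $\rho(\gamma)v_1\cdot\rho(\gamma)v_2=\rho(\gamma)(v_1\cdot v_2)$; (viii) $\eta(\rho(\gamma)v_1,\rho(\gamma)v_2)=\eta(v_1,v_2)$; (ix) $\eta(v_1\cdot v_2,v_3)=\eta(v_1,v_2\cdot v_3)$; (x) $\mathbf 1\in\mathscr H_1$ is a two-sided identity with $\rho(\gamma)\mathbf 1=\mathbf 1$ for all $\gamma$; (xi) (trace axiom) for all $a,b\in\Gamma$ and $v\in\mathscr H_{[a,b]}$ ($[a,b]=aba^{-1}b^{-1}$), with $L_v$ left multiplication by $v$, $\mathrm{Tr}_{\mathscr H_a}(L_v\rho(b^{-1}))=\mathrm{Tr}_{\mathscr H_b}(\rho(a)L_v)$. It is moreover assumed $\mathbb Q$-graded: $\mathscr H=\bigoplus_{r\in\mathbb Q}\mathscr H_r$ with $\mathscr H_r=0$ for $r<0$ or $r>2d$ for some integer $d\ge0$; the $\Gamma$-action, $\Gamma$-grading and multiplication respect this grading and $\eta$ has degree $-2d$. Coinvariants: $\pi_K:\mathscr H\to\mathscr H$, $\pi_K(v)=\frac1{|K|}\sum_{k\in K}\rho(k)v$, and $\mathscr H^K:=\pi_K(\mathscr H)$. Its $L$-grading is $\mathscr H^K=\bigoplus_{l\in L}\mathscr H^K_{[l]}$ with $\mathscr H^K_{[l]}:=\pi_K\big(\bigoplus_{k\in K}\mathscr H_{kl}\big)$; the $L$-action, product, identity and metric are the restrictions of those of $\mathscr H$. *)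

theory Defs
  imports Complex_Main "HOL-Algebra.Group"
begin

section \<open>Linear algebra on subspaces of an ambient vector space\<close>

context vector_space
begin

text \<open>Only finite partial sums occur in the independence clause, so the index set may be infinite.\<close>

definition internal_direct_sum :: "'b set \<Rightarrow> 'i set \<Rightarrow> ('i \<Rightarrow> 'b set) \<Rightarrow> bool" where
  "internal_direct_sum V I U \<longleftrightarrow>
     (\<forall>i\<in>I. subspace (U i)) \<and>
     V = span (\<Union>i\<in>I. U i) \<and>
     (\<forall>J x. finite J \<and> J \<subseteq> I \<and> (\<forall>j\<in>J. x j \<in> U j) \<and> (\<Sum>j\<in>J. x j) = 0 \<longrightarrow> (\<forall>j\<in>J. x j = 0))"

definition linear_on :: "'b set \<Rightarrow> ('b \<Rightarrow> 'b) \<Rightarrow> bool" where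
  "linear_on V f \<longleftrightarrow>
     (\<forall>x\<in>V. \<forall>y\<in>V. f (x + y) = f x + f y) \<and> (\<forall>c. \<forall>x\<in>V. f (scale c x) = scale c (f x))"

text \<open>The trace of an endomorphism of a finite-dimensional subspace; the value does not
  depend on the chosen basis.\<close>

definition trace_on :: "'b set \<Rightarrow> ('b \<Rightarrow> 'b) \<Rightarrow> 'a" where
  "trace_on U f =
     (let B = (SOME B. independent B \<and> span B = U) in \<Sum>b\<in>B. representation B (f b) b)"

end


section \<open>Semidirect products for right actions\<close>

locale right_aut_action = K: group K + L: group L
  for K :: "('k, 'm) monoid_scheme" and L :: "('l, 'n) monoid_scheme" +
  fixes \<alpha> :: "'l \<Rightarrow> 'k \<Rightarrow> 'k"
  assumes act_iso: "l \<in> carrier L \<Longrightarrow> \<alpha> l \<in> iso K K"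
    and act_one: "k \<in> carrier K \<Longrightarrow> \<alpha> \<one>\<^bsub>L\<^esub> k = k"
    and act_mult: "\<lbrakk>l \<in> carrier L; l' \<in> carrier L; k \<in> carrier K\<rbrakk>
      \<Longrightarrow> \<alpha> (l \<otimes>\<^bsub>L\<^esub> l') k = \<alpha> l' (\<alpha> l k)"

text \<open>The pair \<open>(k, l)\<close> stands for the product \<open>k l\<close>. The multiplication is forced by
  \<open>(k l) (k' l') = k (l k' l\<^sup>-\<^sup>1) (l l')\<close> together with \<open>\<alpha> l k = l\<^sup>-\<^sup>1 k l\<close>; see the lemma
  \<open>semidirect_conj\<close> below.\<close>

definition semidirect ::
  "('k, 'm) monoid_scheme \<Rightarrow> ('l, 'n) monoid_scheme \<Rightarrow> ('l \<Rightarrow> 'k \<Rightarrow> 'k) \<Rightarrow> ('k \<times> 'l) monoid" where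
  "semidirect K L \<alpha> =
     \<lparr>carrier = carrier K \<times> carrier L,
      mult = (\<lambda>(k, l) (k', l'). (k \<otimes>\<^bsub>K\<^esub> \<alpha> (inv\<^bsub>L\<^esub> l) k', l \<otimes>\<^bsub>L\<^esub> l')),
      one = (\<one>\<^bsub>K\<^esub>, \<one>\<^bsub>L\<^esub>)\<rparr>"

context right_aut_action
begin

lemma act_closed: "\<lbrakk>l \<in> carrier L; k \<in> carrier K\<rbrakk> \<Longrightarrow> \<alpha> l k \<in> carrier K"
  using act_iso[of l] by (auto simp: iso_def hom_def)

lemma act_hom: "\<lbrakk>l \<in> carrier L; k \<in> carrier K; k' \<in> carrier K\<rbrakk>
    \<Longrightarrow> \<alpha> l (k \<otimes>\<^bsub>K\<^esub> k') = \<alpha> l k \<otimes>\<^bsub>K\<^esub> \<alpha> l k'"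
  using act_iso[of l] by (auto simp: iso_def hom_def)

lemma act_unit: "l \<in> carrier L \<Longrightarrow> \<alpha> l \<one>\<^bsub>K\<^esub> = \<one>\<^bsub>K\<^esub>"
  using act_hom[of l "\<one>\<^bsub>K\<^esub>" "\<one>\<^bsub>K\<^esub>"] act_closed[of l "\<one>\<^bsub>K\<^esub>"] K.l_cancel_one[of "\<alpha> l \<one>\<^bsub>K\<^esub>"]
  by fastforce

lemma semidirect_group: "group (semidirect K L \<alpha>)"
proof (rule groupI)
  fix x y z
  assume "x \<in> carrier (semidirect K L \<alpha>)" "y \<in> carrier (semidirect K L \<alpha>)"
    "z \<in> carrier (semidirect K L \<alpha>)"
  then show "x \<otimes>\<^bsub>semidirect K L \<alpha>\<^esub> y \<otimes>\<^bsub>semidirect K L \<alpha>\<^esub> z =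
      x \<otimes>\<^bsub>semidirect K L \<alpha>\<^esub> (y \<otimes>\<^bsub>semidirect K L \<alpha>\<^esub> z)"
    by (auto simp: semidirect_def act_closed act_hom act_mult L.inv_mult_group K.m_assoc L.m_assoc)
next
  fix x assume "x \<in> carrier (semidirect K L \<alpha>)"
  then obtain k l where x: "x = (k, l)" "k \<in> carrier K" "l \<in> carrier L"
    by (auto simp: semidirect_def)
  have "\<alpha> l (inv\<^bsub>K\<^esub> k) \<otimes>\<^bsub>K\<^esub> \<alpha> l k = \<one>\<^bsub>K\<^esub>"
    using x act_hom[of l "inv\<^bsub>K\<^esub> k" k] by (simp add: act_unit)
  then show "\<exists>y\<in>carrier (semidirect K L \<alpha>).
      y \<otimes>\<^bsub>semidirect K L \<alpha>\<^esub> x = \<one>\<^bsub>semidirect K L \<alpha>\<^esub>"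
    using x by (intro bexI[of _ "(\<alpha> l (inv\<^bsub>K\<^esub> k), inv\<^bsub>L\<^esub> l)"])
      (auto simp: semidirect_def act_closed)
qed (auto simp: semidirect_def act_closed act_one)

lemma semidirect_conj:
  assumes "k \<in> carrier K" "l \<in> carrier L"
  shows "inv\<^bsub>semidirect K L \<alpha>\<^esub> (\<one>\<^bsub>K\<^esub>, l) \<otimes>\<^bsub>semidirect K L \<alpha>\<^esub> (k, \<one>\<^bsub>L\<^esub>)
           \<otimes>\<^bsub>semidirect K L \<alpha>\<^esub> (\<one>\<^bsub>K\<^esub>, l) = (\<alpha> l k, \<one>\<^bsub>L\<^esub>)"
proof -
  interpret S: group "semidirect K L \<alpha>" by (rule semidirect_group)
  have "inv\<^bsub>semidirect K L \<alpha>\<^esub> (\<one>\<^bsub>K\<^esub>, l) = (\<one>\<^bsub>K\<^esub>, inv\<^bsub>L\<^esub> l)"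
    using assms by (intro S.inv_equality) (auto simp: semidirect_def act_unit)
  then show ?thesis
    using assms by (simp add: semidirect_def act_unit act_closed)
qed

end


section \<open>Frobenius algebras graded by a finite group\<close>

text \<open>The underlying space \<open>hspace\<close> is a subspace of an ambient rational vector space with
  scalar multiplication \<open>scale\<close>; the operations are only meaningful on \<open>hspace\<close>.
  \<open>gcomp H m\<close> is \<open>H\<^sub>m\<close> for a group element \<open>m\<close>, \<open>qcomp H r\<close> is \<open>H\<^sub>r\<close> for a rational \<open>r\<close>,
  and \<open>gact H \<gamma>\<close> is \<open>\<rho>(\<gamma>)\<close>.\<close>

record ('g, 'v) frob_data =
  hspace :: "'v set"
  gcomp :: "'g \<Rightarrow> 'v set"
  qcomp :: "rat \<Rightarrow> 'v set"
  gact :: "'g \<Rightarrow> 'v \<Rightarrow> 'v"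
  hmult :: "'v \<Rightarrow> 'v \<Rightarrow> 'v"
  hone :: "'v"
  metric :: "'v \<Rightarrow> 'v \<Rightarrow> rat"

text \<open>The action is a right action: \<open>\<rho>(\<gamma>\<delta>)\<close> first applies \<open>\<rho>(\<gamma>)\<close> and then \<open>\<rho>(\<delta>)\<close>.\<close>

locale graded_group_module = vector_space scale + group G
  for scale :: "rat \<Rightarrow> 'v::ab_group_add \<Rightarrow> 'v"
    and G :: "('g, 'm) monoid_scheme" (structure) +
  fixes V :: "'v set" and comp :: "'g \<Rightarrow> 'v set" and \<rho> :: "'g \<Rightarrow> 'v \<Rightarrow> 'v"
  assumes finite_group: "finite (carrier G)"
    and space_subspace: "subspace V"
    and space_finite_dim: "\<exists>B. finite B \<and> span B = V"
    and grading: "internal_direct_sum V (carrier G) comp"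
    and action_closed: "\<lbrakk>\<gamma> \<in> carrier G; v \<in> V\<rbrakk> \<Longrightarrow> \<rho> \<gamma> v \<in> V"
    and action_linear: "\<gamma> \<in> carrier G \<Longrightarrow> linear_on V (\<rho> \<gamma>)"
    and action_one: "v \<in> V \<Longrightarrow> \<rho> \<one> v = v"
    and action_mult: "\<lbrakk>\<gamma> \<in> carrier G; \<delta> \<in> carrier G; v \<in> V\<rbrakk> \<Longrightarrow> \<rho> (\<gamma> \<otimes> \<delta>) v = \<rho> \<delta> (\<rho> \<gamma> v)"
    and action_grading: "\<lbrakk>\<gamma> \<in> carrier G; m \<in> carrier G; v \<in> comp m\<rbrakk>
      \<Longrightarrow> \<rho> \<gamma> v \<in> comp (inv \<gamma> \<otimes> m \<otimes> \<gamma>)"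

locale frobenius_algebra =
  graded_group_module scale G "hspace H" "gcomp H" "gact H"
  for scale :: "rat \<Rightarrow> 'v::ab_group_add \<Rightarrow> 'v"
    and G :: "('g, 'm) monoid_scheme" (structure)
    and d :: nat
    and H :: "('g, 'v) frob_data" +
  assumes self_invariant: "\<lbrakk>\<gamma> \<in> carrier G; v \<in> gcomp H \<gamma>\<rbrakk> \<Longrightarrow> gact H \<gamma> v = v"
    and metric_add: "\<lbrakk>u \<in> hspace H; v \<in> hspace H; w \<in> hspace H\<rbrakk>
      \<Longrightarrow> metric H (u + v) w = metric H u w + metric H v w"
    and metric_scale: "\<lbrakk>v \<in> hspace H; w \<in> hspace H\<rbrakk>
      \<Longrightarrow> metric H (scale c v) w = c * metric H v w"
    and metric_sym: "\<lbrakk>v \<in> hspace H; w \<in> hspace H\<rbrakk> \<Longrightarrow> metric H v w = metric H w v"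
    and metric_nondegenerate:
      "\<lbrakk>v \<in> hspace H; \<forall>w\<in>hspace H. metric H v w = 0\<rbrakk> \<Longrightarrow> v = 0"
    and metric_grading: "\<lbrakk>m \<in> carrier G; n \<in> carrier G; v \<in> gcomp H m; w \<in> gcomp H n;
      metric H v w \<noteq> 0\<rbrakk> \<Longrightarrow> m \<otimes> n = \<one>"
    and mult_closed: "\<lbrakk>v \<in> hspace H; w \<in> hspace H\<rbrakk> \<Longrightarrow> hmult H v w \<in> hspace H"
    and mult_linear_left: "w \<in> hspace H \<Longrightarrow> linear_on (hspace H) (\<lambda>v. hmult H v w)"
    and mult_linear_right: "v \<in> hspace H \<Longrightarrow> linear_on (hspace H) (\<lambda>w. hmult H v w)"
    and mult_grading: "\<lbrakk>m \<in> carrier G; n \<in> carrier G; v \<in> gcomp H m; w \<in> gcomp H n\<rbrakk>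
      \<Longrightarrow> hmult H v w \<in> gcomp H (m \<otimes> n)"
    and mult_assoc: "\<lbrakk>u \<in> hspace H; v \<in> hspace H; w \<in> hspace H\<rbrakk>
      \<Longrightarrow> hmult H (hmult H u v) w = hmult H u (hmult H v w)"
    and mult_twisted_comm: "\<lbrakk>m \<in> carrier G; n \<in> carrier G; v \<in> gcomp H m; w \<in> gcomp H n\<rbrakk>
      \<Longrightarrow> hmult H v w = hmult H (gact H (inv m) w) v"
    and mult_equivariant: "\<lbrakk>\<gamma> \<in> carrier G; v \<in> hspace H; w \<in> hspace H\<rbrakk>
      \<Longrightarrow> hmult H (gact H \<gamma> v) (gact H \<gamma> w) = gact H \<gamma> (hmult H v w)"
    and metric_invariant: "\<lbrakk>\<gamma> \<in> carrier G; v \<in> hspace H; w \<in> hspace H\<rbrakk>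
      \<Longrightarrow> metric H (gact H \<gamma> v) (gact H \<gamma> w) = metric H v w"
    and metric_mult: "\<lbrakk>u \<in> hspace H; v \<in> hspace H; w \<in> hspace H\<rbrakk>
      \<Longrightarrow> metric H (hmult H u v) w = metric H u (hmult H v w)"
    and one_grading: "hone H \<in> gcomp H \<one>"
    and one_left: "v \<in> hspace H \<Longrightarrow> hmult H (hone H) v = v"
    and one_right: "v \<in> hspace H \<Longrightarrow> hmult H v (hone H) = v"
    and one_invariant: "\<gamma> \<in> carrier G \<Longrightarrow> gact H \<gamma> (hone H) = hone H"
      \<comment> \<open>\<open>v\<close> has degree \<open>[a, b]\<close>, so both composites are endomorphisms\<close>
    and trace_axiom: "\<lbrakk>a \<in> carrier G; b \<in> carrier G; v \<in> gcomp H (a \<otimes> b \<otimes> inv a \<otimes> inv b)\<rbrakk>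
      \<Longrightarrow> trace_on (gcomp H a) (\<lambda>x. hmult H v (gact H (inv b) x)) =
          trace_on (gcomp H b) (\<lambda>x. gact H a (hmult H v x))"
    and rat_grading: "internal_direct_sum (hspace H) UNIV (qcomp H)"
    and rat_grading_bounds: "r < 0 \<or> r > 2 * of_nat d \<Longrightarrow> qcomp H r = {0}"
    and rat_grading_action: "\<lbrakk>\<gamma> \<in> carrier G; v \<in> qcomp H r\<rbrakk> \<Longrightarrow> gact H \<gamma> v \<in> qcomp H r"
    and rat_grading_group: "m \<in> carrier G
      \<Longrightarrow> internal_direct_sum (gcomp H m) UNIV (\<lambda>r. gcomp H m \<inter> qcomp H r)"
    and rat_grading_mult: "\<lbrakk>v \<in> qcomp H r; w \<in> qcomp H s\<rbrakk> \<Longrightarrow> hmult H v w \<in> qcomp H (r + s)"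
    and rat_grading_metric: "\<lbrakk>v \<in> qcomp H r; w \<in> qcomp H s; metric H v w \<noteq> 0\<rbrakk>
      \<Longrightarrow> r + s = 2 * of_nat d"


section \<open>Coinvariants\<close>

text \<open>Elements \<open>k\<close> of \<open>K\<close>, \<open>l\<close> of \<open>L\<close> and \<open>k l\<close> of the semidirect product are the pairs
  \<open>(k, \<one>)\<close>, \<open>(\<one>, l)\<close> and \<open>(k, l)\<close>. The rational grading of the coinvariants is the image
  under the projection, which is also the restriction of that of \<open>H\<close>, as the action
  preserves the rational grading.\<close>

definition coinv_proj ::
  "(rat \<Rightarrow> 'v::ab_group_add \<Rightarrow> 'v) \<Rightarrow> ('k, 'm) monoid_scheme \<Rightarrow> ('l, 'n) monoid_scheme
    \<Rightarrow> ('k \<times> 'l, 'v) frob_data \<Rightarrow> 'v \<Rightarrow> 'v" where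
  "coinv_proj scale K L H v =
     scale (1 / of_nat (card (carrier K))) (\<Sum>k\<in>carrier K. gact H (k, \<one>\<^bsub>L\<^esub>) v)"

definition coinvariants ::
  "(rat \<Rightarrow> 'v::ab_group_add \<Rightarrow> 'v) \<Rightarrow> ('k, 'm) monoid_scheme \<Rightarrow> ('l, 'n) monoid_scheme
    \<Rightarrow> ('k \<times> 'l, 'v) frob_data \<Rightarrow> ('l, 'v) frob_data" where
  "coinvariants scale K L H =
     \<lparr>hspace = coinv_proj scale K L H ` hspace H,
      gcomp = (\<lambda>l. coinv_proj scale K L H ` module.span scale (\<Union>k\<in>carrier K. gcomp H (k, l))),
      qcomp = (\<lambda>r. coinv_proj scale K L H ` qcomp H r),
      gact = (\<lambda>l. gact H (\<one>\<^bsub>K\<^esub>, l)),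
      hmult = hmult H,
      hone = hone H,
      metric = metric H\<rparr>"

end

theory Submission
  imports Defs
begin

text \<open>Let \<open>W l\<close> be the sum of the \<open>H\<^bsub>kl\<^esub>\<close> over \<open>k\<close> in \<open>K\<close>. The averaging projection preserves each
  \<open>W l\<close> and each rational component, so the coinvariants are the \<open>K\<close>-fixed vectors and
  inherit both gradings; all axioms except the trace axiom are checked on components and
  averaged. For the trace axiom, the trace on the fixed vectors of \<open>W a\<close> is a trace on all of
  \<open>W a\<close> after composing with the projection. Its diagonal blocks turn both sides into averages
  over \<open>(k, j)\<close> in \<open>K \<times> K\<close> of traces, on \<open>H\<^bsub>ka\<^esub>\<close> and on \<open>H\<^bsub>jb\<^esub>\<close>, which involve only the
  component of \<open>v\<close> of degree \<open>[ka, jb]\<close> and agree by the trace axiom of \<open>H\<close>.\<close>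

section \<open>Direct sums and traces\<close>

context vector_space
begin

section \<open>Maps that are linear on a subspace\<close>

lemma linear_on_add: "linear_on V f \<Longrightarrow> x \<in> V \<Longrightarrow> y \<in> V \<Longrightarrow> f (x + y) = f x + f y"
  by (simp add: linear_on_def)

lemma linear_on_scale: "linear_on V f \<Longrightarrow> x \<in> V \<Longrightarrow> f (scale c x) = scale c (f x)"
  by (simp add: linear_on_def)

lemma linear_on_zero:
  assumes "linear_on V f" "subspace V"
  shows "f 0 = 0"
  using linear_on_scale[OF assms(1) subspace_0[OF assms(2)], of 0] by simp

lemma linear_on_sum:
  assumes "linear_on V f" "subspace V" "\<And>i. i \<in> I \<Longrightarrow> x i \<in> V"
  shows "f (\<Sum>i\<in>I. x i) = (\<Sum>i\<in>I. f (x i))"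
  using assms(3)
proof (induction I rule: infinite_finite_induct)
  case (insert i I)
  then show ?case
    using assms by (simp add: linear_on_add[OF assms(1)] subspace_sum[OF assms(2)])
qed (use assms in \<open>auto simp: linear_on_zero\<close>)

text \<open>\<open>linear_on\<close> says nothing outside \<open>V\<close>, so the induction has to
  carry membership in \<open>V\<close> along with the claim about \<open>f\<close>.\<close>

lemma linear_on_span:
  assumes "linear_on V f" "subspace V" "A \<subseteq> V" "f ` A \<subseteq> T" "subspace T" "x \<in> span A"
  shows "f x \<in> T"
proof -
  have "x \<in> V \<and> f x \<in> T"
    using assms(6)
  proof (induction rule: span_induct_alt)
    case base
    then show ?case using assms by (simp add: linear_on_zero subspace_0)
  next
    case (step c y z)
    then have "y \<in> V" "f y \<in> T" using assms(3,4) by auto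
    with step show ?case
      using assms by (simp add: linear_on_add[OF assms(1)] linear_on_scale[OF assms(1)]
          subspace_add subspace_scale)
  qed
  then show ?thesis ..
qed

lemma linear_on_subset: "linear_on V f \<Longrightarrow> U \<subseteq> V \<Longrightarrow> linear_on U f"
  by (simp add: linear_on_def subset_iff)

lemma linear_on_compose:
  assumes "linear_on V f" "linear_on V g" "\<And>x. x \<in> V \<Longrightarrow> f x \<in> V"
  shows "linear_on V (\<lambda>x. g (f x))"
  using assms by (simp add: linear_on_def)

lemma linear_on_scaled: "linear_on V f \<Longrightarrow> linear_on V (\<lambda>x. scale c (f x))"
  by (simp add: linear_on_def scale_right_distrib scale_left_commute)

lemma linear_on_sum_fun:
  assumes "\<And>i. i \<in> I \<Longrightarrow> linear_on V (f i)"
  shows "linear_on V (\<lambda>x. \<Sum>i\<in>I. f i x)"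
  using assms by (simp add: linear_on_def sum.distrib scale_sum_right)

text \<open>The difference of \<open>f\<close> and \<open>g\<close> is linear and sends
  \<open>A\<close> to the zero subspace, hence the span as well. Identities on homogeneous
  components extend to sums of components in this way.\<close>

lemma linear_on_eq_span:
  assumes "linear_on V f" "linear_on V g" "subspace V" "A \<subseteq> V"
    "\<And>x. x \<in> A \<Longrightarrow> f x = g x" "x \<in> span A"
  shows "f x = g x"
proof -
  have "linear_on V (\<lambda>x. f x - g x)"
    using assms(1,2) by (simp add: linear_on_def algebra_simps scale_right_diff_distrib)
  then have "f x - g x \<in> {0}"
    by (rule linear_on_span[OF _ assms(3,4) _ subspace_single_0 assms(6)]) (use assms(5) in auto)
  then show ?thesis by simp
qed

lemma subspace_linear_image:
  assumes "linear_on V f" "subspace V" "subspace U" "U \<subseteq> V"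
  shows "subspace (f ` U)"
  unfolding subspace_def
proof (intro conjI ballI allI)
  show "0 \<in> f ` U"
    using linear_on_zero[OF assms(1,2)] subspace_0[OF assms(3)] by force
next
  fix x y assume "x \<in> f ` U" "y \<in> f ` U"
  then obtain u v where uv: "u \<in> U" "v \<in> U" "x = f u" "y = f v" by auto
  then have "x + y = f (u + v)" using linear_on_add[OF assms(1)] assms(4) by (metis subsetD)
  then show "x + y \<in> f ` U" using uv subspace_add[OF assms(3)] by blast
next
  fix c x assume "x \<in> f ` U"
  then obtain u where u: "u \<in> U" "x = f u" by auto
  then have "scale c x = f (scale c u)" using linear_on_scale[OF assms(1), of u c] assms(4) by auto
  then show "scale c x \<in> f ` U" using u subspace_scale[OF assms(3)] by blast
qed

section \<open>Internal direct sums\<close>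

lemma span_UN_finite:
  assumes "finite I" "\<And>i. i \<in> I \<Longrightarrow> subspace (U i)" "x \<in> span (\<Union>i\<in>I. U i)"
  shows "\<exists>y. (\<forall>i\<in>I. y i \<in> U i) \<and> x = (\<Sum>i\<in>I. y i)"
  using assms(3)
proof (induction rule: span_induct_alt)
  case base
  show ?case using assms(2) by (intro exI[of _ "\<lambda>_. 0"]) (auto simp: subspace_0)
next
  case (step c u z)
  obtain j where j: "j \<in> I" "u \<in> U j" using step.hyps by auto
  obtain y where y: "\<forall>i\<in>I. y i \<in> U i" "z = (\<Sum>i\<in>I. y i)" using step.IH by auto
  \<comment> \<open>The new summand is absorbed into component \<open>j\<close>, which keeps exactly
    one term per index.\<close>
  define y' where "y' i = (if i = j then scale c u else 0) + y i" for i
  have "(\<Sum>i\<in>I. y' i) = scale c u + z"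
    using j assms(1) y by (simp add: y'_def sum.distrib sum.delta)
  moreover have "y' i \<in> U i" if "i \<in> I" for i
    using that j y assms(2) by (auto simp: y'_def subspace_add subspace_scale)
  ultimately show ?case by (intro exI[of _ y']) auto
qed

lemma internal_direct_sum_subspace:
  "internal_direct_sum V I U \<Longrightarrow> i \<in> I \<Longrightarrow> subspace (U i)"
  by (simp add: internal_direct_sum_def)

lemma internal_direct_sum_subset:
  "internal_direct_sum V I U \<Longrightarrow> i \<in> I \<Longrightarrow> U i \<subseteq> V"
  by (auto simp: internal_direct_sum_def intro: span_base)

lemma internal_direct_sum_span:
  "internal_direct_sum V I U \<Longrightarrow> span (\<Union>i\<in>I. U i) = V"
  by (simp add: internal_direct_sum_def)

lemma internal_direct_sum_space: "internal_direct_sum V I U \<Longrightarrow> subspace V"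
  by (metis internal_direct_sum_span subspace_span)

lemma internal_direct_sum_independent:
  assumes "internal_direct_sum V I U" "finite J" "J \<subseteq> I" "\<And>j. j \<in> J \<Longrightarrow> x j \<in> U j"
    "(\<Sum>j\<in>J. x j) = 0" "j \<in> J"
  shows "x j = 0"
proof -
  have "\<forall>j\<in>J. x j = 0"
    using assms unfolding internal_direct_sum_def by blast
  then show ?thesis using assms(6) by blast
qed

text \<open>Independence passes to smaller components, so beyond their being subspaces only the
  space they span has to be identified.\<close>

lemma internal_direct_sum_smaller:
  assumes "internal_direct_sum V I U" "\<And>i. i \<in> I \<Longrightarrow> subspace (T i)"
    "\<And>i. i \<in> I \<Longrightarrow> T i \<subseteq> U i" "W = span (\<Union>i\<in>I. T i)"
  shows "internal_direct_sum W I T"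
  unfolding internal_direct_sum_def
proof (intro conjI allI impI ballI)
  fix J x j
  assume *: "finite J \<and> J \<subseteq> I \<and> (\<forall>j\<in>J. x j \<in> T j) \<and> (\<Sum>j\<in>J. x j) = 0" "j \<in> J"
  then show "x j = 0"
    using assms(3) internal_direct_sum_independent[OF assms(1), of J x j] by blast
qed (use assms(2,4) in blast)+

text \<open>Since \<open>p\<close> maps each component into itself, the images are smaller
  components of the same sum and inherit independence; linearity carries spanning over. With
  \<open>p\<close> the averaging projection this grades the coinvariants.\<close>

lemma internal_direct_sum_image:
  assumes "internal_direct_sum V I U" "linear_on V p" "\<And>i. i \<in> I \<Longrightarrow> p ` U i \<subseteq> U i"
  shows "internal_direct_sum (p ` V) I (\<lambda>i. p ` U i)"
proof (rule internal_direct_sum_smaller[OF assms(1)])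
  have V: "subspace V" by (rule internal_direct_sum_space[OF assms(1)])
  note sub = internal_direct_sum_subset[OF assms(1)]
  show "subspace (p ` U i)" if "i \<in> I" for i
    by (rule subspace_linear_image[OF assms(2) V internal_direct_sum_subspace[OF assms(1) that] sub[OF that]])
  show "p ` V = span (\<Union>i\<in>I. p ` U i)"
  proof
    show "p ` V \<subseteq> span (\<Union>i\<in>I. p ` U i)"
    proof
      fix y assume "y \<in> p ` V"
      then obtain x where x: "y = p x" "x \<in> span (\<Union>i\<in>I. U i)"
        using internal_direct_sum_span[OF assms(1)] by auto
      show "y \<in> span (\<Union>i\<in>I. p ` U i)"
        unfolding x(1)
        proof (rule linear_on_span[OF assms(2) V _ _ subspace_span x(2)])
          show "(\<Union>i\<in>I. U i) \<subseteq> V" using sub by blast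
          show "p ` (\<Union>i\<in>I. U i) \<subseteq> span (\<Union>i\<in>I. p ` U i)"
            using span_superset[of "\<Union>i\<in>I. p ` U i"] by blast
        qed
    qed
    show "span (\<Union>i\<in>I. p ` U i) \<subseteq> p ` V"
      using sub by (intro span_minimal subspace_linear_image[OF assms(2) V V order_refl]) auto
  qed
qed (rule assms(3))

lemma internal_direct_sum_slice:
  assumes "internal_direct_sum V (A \<times> B) U" "b \<in> B"
  shows "internal_direct_sum (span (\<Union>a\<in>A. U (a, b))) A (\<lambda>a. U (a, b))"
  unfolding internal_direct_sum_def
proof (intro conjI allI impI ballI)
  fix J x j
  assume *: "finite J \<and> J \<subseteq> A \<and> (\<forall>j\<in>J. x j \<in> U (j, b)) \<and> (\<Sum>j\<in>J. x j) = 0" "j \<in> J"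
  have "(\<Sum>i\<in>(\<lambda>a. (a, b)) ` J. x (fst i)) = 0"
    using * by (subst sum.reindex) (auto simp: inj_on_def)
  then have "x (fst (j, b)) = 0"
    using * assms(2)
    by (intro internal_direct_sum_independent[OF assms(1), of "(\<lambda>a. (a, b)) ` J" "\<lambda>i. x (fst i)"]) auto
  then show "x j = 0" by simp
qed (use assms in \<open>auto intro: internal_direct_sum_subspace\<close>)

text \<open>Splitting every summand into its \<open>A\<close>-components turns a vanishing sum over
  \<open>J\<close> into one over \<open>A \<times> J\<close>, to which the finer independence
  applies. This makes a grading by pairs into a grading by the second factor.\<close>

lemma internal_direct_sum_group:
  assumes "internal_direct_sum V (A \<times> B) U" "finite A"
  shows "internal_direct_sum V B (\<lambda>b. span (\<Union>a\<in>A. U (a, b)))"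
  unfolding internal_direct_sum_def
proof (intro conjI allI impI ballI)
  show "V = span (\<Union>b\<in>B. span (\<Union>a\<in>A. U (a, b)))"
  proof
    show "V \<subseteq> span (\<Union>b\<in>B. span (\<Union>a\<in>A. U (a, b)))"
      unfolding internal_direct_sum_span[OF assms(1), symmetric]
      by (intro span_mono) (auto intro!: bexI span_base)
    have "subspace V" by (rule internal_direct_sum_space[OF assms(1)])
    then show "span (\<Union>b\<in>B. span (\<Union>a\<in>A. U (a, b))) \<subseteq> V"
      using internal_direct_sum_subset[OF assms(1)] by (intro span_minimal UN_least) auto
  qed
next
  fix J x j
  assume *: "finite J \<and> J \<subseteq> B \<and> (\<forall>j\<in>J. x j \<in> span (\<Union>a\<in>A. U (a, j))) \<and> (\<Sum>j\<in>J. x j) = 0"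
    and j: "j \<in> J"
  have "\<exists>y. (\<forall>a\<in>A. y a \<in> U (a, b)) \<and> x b = (\<Sum>a\<in>A. y a)" if "b \<in> J" for b
  proof -
    have "x b \<in> span (\<Union>a\<in>A. U (a, b))" using that * by auto
    moreover have "subspace (U (a, b))" if "a \<in> A" for a
      using that \<open>b \<in> J\<close> * by (intro internal_direct_sum_subspace[OF assms(1)]) auto
    ultimately show ?thesis by (rule span_UN_finite[OF assms(2), rotated])
  qed
  then obtain y where y: "\<And>a b. b \<in> J \<Longrightarrow> a \<in> A \<Longrightarrow> y b a \<in> U (a, b)"
    "\<And>b. b \<in> J \<Longrightarrow> x b = (\<Sum>a\<in>A. y b a)"
    by metis
  have "(\<Sum>(a, b)\<in>A \<times> J. y b a) = (\<Sum>b\<in>J. x b)"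
    by (simp add: y(2) sum.cartesian_product[symmetric] sum.swap[of _ A])
  moreover have "(\<lambda>(a, b). y b a) i \<in> U i" if "i \<in> A \<times> J" for i
    using that y(1) by (cases i) auto
  ultimately have "(\<lambda>(a, b). y b a) (a, j) = 0" if "a \<in> A" for a
    using internal_direct_sum_independent[OF assms(1), of "A \<times> J" "\<lambda>(a, b). y b a" "(a, j)"]
      * j that assms(2) by (simp add: Sigma_mono)
  then show "x j = 0" using y(2)[OF j] by simp
qed simp

lemma internal_direct_sum_projections:
  assumes ds: "internal_direct_sum V I U" and fin: "finite I"
  obtains p where "\<And>i. i \<in> I \<Longrightarrow> linear_on V (p i)"
    "\<And>i x. i \<in> I \<Longrightarrow> x \<in> V \<Longrightarrow> p i x \<in> U i"
    "\<And>x. x \<in> V \<Longrightarrow> x = (\<Sum>i\<in>I. p i x)"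
    "\<And>i j x. i \<in> I \<Longrightarrow> j \<in> I \<Longrightarrow> x \<in> U j \<Longrightarrow> p i x = (if i = j then x else 0)"
proof -
  note sub = internal_direct_sum_subspace[OF ds]
  have V: "subspace V" by (rule internal_direct_sum_space[OF ds])
  have "\<exists>y. (\<forall>i\<in>I. y i \<in> U i) \<and> x = (\<Sum>i\<in>I. y i)" if "x \<in> V" for x
    using span_UN_finite[OF fin, of U x] sub that internal_direct_sum_span[OF ds] by blast
  then obtain q where q: "\<And>x i. x \<in> V \<Longrightarrow> i \<in> I \<Longrightarrow> q x i \<in> U i"
    "\<And>x. x \<in> V \<Longrightarrow> x = (\<Sum>i\<in>I. q x i)"
    by metis
  \<comment> \<open>Uniqueness of the components makes the arbitrarily chosen \<open>q\<close>
    linear and determines it on each \<open>U j\<close>.\<close>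
  have uniq: "q x i = y i" if "x \<in> V" "\<And>i. i \<in> I \<Longrightarrow> y i \<in> U i" "x = (\<Sum>i\<in>I. y i)" "i \<in> I" for x y i
  proof -
    have "(\<Sum>i\<in>I. q x i - y i) = 0"
      using that(3) q(2)[OF that(1)] by (simp add: sum_subtractf)
    then have "q x i - y i = 0"
      using that q(1) sub fin
      by (intro internal_direct_sum_independent[OF ds fin order_refl, of "\<lambda>i. q x i - y i"])
        (auto intro: subspace_diff)
    then show ?thesis by simp
  qed
  show ?thesis
  proof (rule that[of "\<lambda>i x. q x i"])
    fix i assume i: "i \<in> I"
    show "linear_on V (\<lambda>x. q x i)"
      unfolding linear_on_def
    proof (intro conjI ballI allI)
      fix x y assume "x \<in> V" "y \<in> V"
      then show "q (x + y) i = q x i + q y i"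
        using i q sub subspace_add[OF V]
        by (intro uniq) (auto simp: sum.distrib intro: subspace_add)
    next
      fix c x assume x: "x \<in> V"
      then show "q (scale c x) i = scale c (q x i)"
        using i q sub subspace_scale[OF V]
        by (intro uniq) (auto simp: scale_sum_right[symmetric] intro: subspace_scale)
    qed
  next
    fix i j x assume "i \<in> I" "j \<in> I" "x \<in> U j"
    then show "q x i = (if i = j then x else 0)"
      using fin sub internal_direct_sum_subset[OF ds, of j]
      by (intro uniq) (auto simp: sum.delta subspace_0)
  qed (use q in auto)
qed

section \<open>Traces\<close>

text \<open>The basis chosen by \<open>SOME\<close> does not depend on the map, so one basis
  computes the trace of every \<open>f\<close>; its finiteness comes from the finite spanning set
  \<open>C\<close>.\<close>

lemma trace_on_basis:
  assumes "finite C" "V \<subseteq> span C" "subspace V"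
  obtains B where "finite B" "independent B" "span B = V"
    "\<And>f. trace_on V f = (\<Sum>b\<in>B. representation B (f b) b)"
proof -
  obtain B0 where B0: "B0 \<subseteq> V" "independent B0" "V \<subseteq> span B0"
    by (rule maximal_independent_subset)
  then have "span B0 = V" using assms(3) by (simp add: span_minimal subset_antisym)
  define B where "B = (SOME B. independent B \<and> span B = V)"
  have B: "independent B \<and> span B = V"
    unfolding B_def by (rule someI[of _ B0]) (use B0 \<open>span B0 = V\<close> in auto)
  then have "finite B"
    using independent_span_bound[OF assms(1), of B] span_superset[of B] assms(2) by auto
  then show ?thesis using B that by (auto simp: trace_on_def Let_def B_def)
qed

lemma trace_on_cong:
  assumes "finite C" "V \<subseteq> span C" "subspace V" "\<And>x. x \<in> V \<Longrightarrow> f x = g x"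
  shows "trace_on V f = trace_on V g"
proof -
  obtain B where "finite B" "independent B" "span B = V"
    "\<And>f. trace_on V f = (\<Sum>b\<in>B. representation B (f b) b)"
    using trace_on_basis[OF assms(1-3)] by metis
  then show ?thesis using assms(4) span_superset[of B] by (auto intro!: sum.cong)
qed

text \<open>This one identity yields both additivity of the trace over block decompositions and,
  for a singleton \<open>I\<close>, the comparison of the traces on a space and on a subspace
  containing the image.\<close>

lemma trace_on_sum:
  assumes C: "finite C" "V \<subseteq> span C" and V: "subspace V"
    and U: "\<And>i. i \<in> I \<Longrightarrow> subspace (U i)" "\<And>i. i \<in> I \<Longrightarrow> U i \<subseteq> V"
    and g: "\<And>i. i \<in> I \<Longrightarrow> linear_on V (g i)" "\<And>i x. i \<in> I \<Longrightarrow> x \<in> V \<Longrightarrow> g i x \<in> U i"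
    and f: "\<And>x. x \<in> V \<Longrightarrow> f x = (\<Sum>i\<in>I. g i x)"
  shows "trace_on V f = (\<Sum>i\<in>I. trace_on (U i) (g i))"
proof -
  obtain B where B: "finite B" "independent B" "span B = V"
    and trB: "\<And>f. trace_on V f = (\<Sum>b\<in>B. representation B (f b) b)"
    using trace_on_basis[OF C V] by metis
  have BV: "b \<in> V" if "b \<in> B" for b using that B(3) span_base by auto
  \<comment> \<open>View \<open>g i\<close> as a map from \<open>V\<close> to \<open>U i\<close>.
    Following it by the inclusion gives an endomorphism of \<open>V\<close>, preceding it by the
    inclusion one of \<open>U i\<close>. In the bases \<open>B\<close> and \<open>D\<close> the
    claim is Tr(PQ) = Tr(QP) for the matrices of the inclusion and of \<open>g i\<close>.\<close>
  have "(\<Sum>b\<in>B. representation B (g i b) b) = trace_on (U i) (g i)" if i: "i \<in> I" for i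
  proof -
    obtain D where D: "finite D" "independent D" "span D = U i"
      and trD: "\<And>f. trace_on (U i) f = (\<Sum>c\<in>D. representation D (f c) c)"
      using trace_on_basis[OF C(1) _ U(1)[OF i]] U(2)[OF i] C(2) by (metis order_trans)
    have DV: "c \<in> V" if "c \<in> D" for c using that D(3) span_base U(2)[OF i] by blast
    have 1: "representation B (g i b) b =
        (\<Sum>c\<in>D. representation D (g i b) c * representation B c b)" if "b \<in> B" for b
    proof -
      have "g i b = (\<Sum>c\<in>D. scale (representation D (g i b) c) c)"
        using sum_representation_eq[OF D(2) _ D(1) order_refl, of "g i b"] g(2)[OF i BV[OF that]] D(3)
        by simp
      then have "representation B (g i b) b =
          representation B (\<Sum>c\<in>D. scale (representation D (g i b) c) c) b" by simp
      also have "\<dots> = (\<Sum>c\<in>D. representation D (g i b) c * representation B c b)"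
        using B(3) V DV by (simp add: representation_sum[OF B(2)] representation_scale[OF B(2)]
            subspace_scale)
      finally show ?thesis .
    qed
    have 2: "(\<Sum>b\<in>B. representation B c b * representation D (g i b) c) =
        representation D (g i c) c" if "c \<in> D" for c
    proof -
      have "g i c = g i (\<Sum>b\<in>B. scale (representation B c b) b)"
        using sum_representation_eq[OF B(2) _ B(1) order_refl, of c] DV[OF that] B(3) by simp
      also have "\<dots> = (\<Sum>b\<in>B. scale (representation B c b) (g i b))"
        using V BV by (simp add: linear_on_sum[OF g(1)[OF i] V] linear_on_scale[OF g(1)[OF i]]
            subspace_scale)
      finally have "representation D (g i c) c =
          representation D (\<Sum>b\<in>B. scale (representation B c b) (g i b)) c" by simp
      also have "\<dots> = (\<Sum>b\<in>B. representation B c b * representation D (g i b) c)"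
        using D(3) U(1)[OF i] BV g(2)[OF i]
        by (simp add: representation_sum[OF D(2)] representation_scale[OF D(2)] subspace_scale)
      finally show ?thesis by simp
    qed
    have "(\<Sum>b\<in>B. representation B (g i b) b) =
        (\<Sum>c\<in>D. \<Sum>b\<in>B. representation B c b * representation D (g i b) c)"
      by (simp add: 1 sum.swap[of _ D] mult.commute)
    then show ?thesis by (simp add: 2 trD)
  qed
  moreover have "trace_on V f = (\<Sum>i\<in>I. \<Sum>b\<in>B. representation B (g i b) b)"
  proof -
    have "representation B (f b) b = (\<Sum>i\<in>I. representation B (g i b) b)" if "b \<in> B" for b
      using f[OF BV[OF that]] g(2)[OF _ BV[OF that]] U(2) B(3)
      by (simp add: representation_sum[OF B(2)] subset_iff)
    then show ?thesis by (simp add: trB sum.swap[of _ B])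
  qed
  ultimately show ?thesis by simp
qed

end

section \<open>Commutators as solutions of degree equations\<close>

context group
begin

text \<open>Acting by the inverse of \<open>b\<close> moves degree \<open>a\<close> to its
  conjugate, and multiplying by degree \<open>x\<close> must bring it back for a diagonal block to
  arise. This selects the component of \<open>v\<close> that contributes to the trace.\<close>

lemma mult_conj_eq_iff:
  assumes "x \<in> carrier G" "a \<in> carrier G" "b \<in> carrier G"
  shows "x \<otimes> (b \<otimes> a \<otimes> inv b) = a \<longleftrightarrow> x = a \<otimes> b \<otimes> inv a \<otimes> inv b"
proof -
  have "x \<otimes> (b \<otimes> a \<otimes> inv b) = a \<longleftrightarrow> x = a \<otimes> inv (b \<otimes> a \<otimes> inv b)"
    using assms inv_solve_right[of x a "b \<otimes> a \<otimes> inv b"] by auto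
  then show ?thesis using assms by (simp add: inv_mult_group m_assoc)
qed

text \<open>The matching condition for the other side of the trace axiom: multiply degree
  \<open>b\<close> by \<open>x\<close>, then act by \<open>a\<close>. The same commutator results,
  so the two block sums can be compared.\<close>

lemma conj_mult_eq_iff:
  assumes "x \<in> carrier G" "a \<in> carrier G" "b \<in> carrier G"
  shows "inv a \<otimes> (x \<otimes> b) \<otimes> a = b \<longleftrightarrow> x = a \<otimes> b \<otimes> inv a \<otimes> inv b"
proof -
  have "inv a \<otimes> (x \<otimes> b) \<otimes> a = b \<longleftrightarrow> inv a \<otimes> (x \<otimes> b) = b \<otimes> inv a"
    using assms inv_solve_right[of "inv a \<otimes> (x \<otimes> b)" b a] by auto
  also have "\<dots> \<longleftrightarrow> x \<otimes> b = a \<otimes> (b \<otimes> inv a)"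
    using assms inv_solve_left[of "b \<otimes> inv a" a "x \<otimes> b"] by auto
  also have "\<dots> \<longleftrightarrow> x = a \<otimes> (b \<otimes> inv a) \<otimes> inv b"
    using assms inv_solve_right[of x "a \<otimes> (b \<otimes> inv a)" b] by auto
  finally show ?thesis using assms by (simp add: m_assoc)
qed

end

section \<open>Coinvariants under the normal factor\<close>

locale semidirect_frobenius =
  right_aut_action K L \<alpha> + frobenius_algebra scale "semidirect K L \<alpha>" d H
  for K :: "('k, 'm) monoid_scheme"
    and L :: "('l, 'n) monoid_scheme"
    and \<alpha> :: "'l \<Rightarrow> 'k \<Rightarrow> 'k"
    and scale :: "rat \<Rightarrow> 'v::ab_group_add \<Rightarrow> 'v"
    and d :: nat
    and H :: "('k \<times> 'l, 'v) frob_data"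
begin

abbreviation "S \<equiv> semidirect K L \<alpha>"
abbreviation "V \<equiv> hspace H"
abbreviation "proj \<equiv> coinv_proj scale K L H"
abbreviation "\<rho> \<equiv> gact H"
abbreviation "W l \<equiv> span (\<Union>k\<in>carrier K. gcomp H (k, l))"
abbreviation "K_inv v \<equiv> \<forall>k\<in>carrier K. \<rho> (k, \<one>\<^bsub>L\<^esub>) v = v"
abbreviation "c \<equiv> 1 / rat_of_nat (card (carrier K))"

section \<open>Degrees in the semidirect product and the coarse grading by \<open>L\<close>\<close>

lemma carrier_S [simp]: "carrier S = carrier K \<times> carrier L"
  by (simp add: semidirect_def)

lemma mult_S [simp]: "(k, l) \<otimes>\<^bsub>S\<^esub> (k', l') = (k \<otimes>\<^bsub>K\<^esub> \<alpha> (inv\<^bsub>L\<^esub> l) k', l \<otimes>\<^bsub>L\<^esub> l')"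
  by (simp add: semidirect_def)

lemma one_S [simp]: "\<one>\<^bsub>S\<^esub> = (\<one>\<^bsub>K\<^esub>, \<one>\<^bsub>L\<^esub>)"
  by (simp add: semidirect_def)

text \<open>With \<open>(k, l)\<close> read as \<open>k l\<close>, the inverse is
  \<open>l^-1 k^-1 = (l^-1 k^-1 l) l^-1\<close>, and the bracket is the action of \<open>l\<close>
  on the inverse of \<open>k\<close>.\<close>

lemma inv_S:
  assumes "k \<in> carrier K" "l \<in> carrier L"
  shows "inv\<^bsub>S\<^esub> (k, l) = (\<alpha> l (inv\<^bsub>K\<^esub> k), inv\<^bsub>L\<^esub> l)"
proof (rule inv_equality)
  show "(\<alpha> l (inv\<^bsub>K\<^esub> k), inv\<^bsub>L\<^esub> l) \<otimes>\<^bsub>S\<^esub> (k, l) = \<one>\<^bsub>S\<^esub>"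
    using assms by (simp add: act_hom[symmetric] act_unit)
qed (use assms act_closed in auto)

lemma finite_K: "finite (carrier K)" and finite_L: "finite (carrier L)"
  using finite_group K.one_closed L.one_closed
  by (auto simp: finite_cartesian_product_iff)

lemma card_K: "rat_of_nat (card (carrier K)) \<noteq> 0"
  using finite_K K.one_closed by auto

lemma bij_act: "l \<in> carrier L \<Longrightarrow> bij_betw (\<alpha> l) (carrier K) (carrier K)"
  using act_iso by (auto simp: iso_def)

lemma gcomp_subspace: "m \<in> carrier S \<Longrightarrow> subspace (gcomp H m)"
  by (rule internal_direct_sum_subspace[OF grading])

lemma gcomp_subset: "m \<in> carrier S \<Longrightarrow> gcomp H m \<subseteq> V"
  by (rule internal_direct_sum_subset[OF grading])

lemma W_sum: "l \<in> carrier L \<Longrightarrow> internal_direct_sum (W l) (carrier K) (\<lambda>k. gcomp H (k, l))"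
  using grading by (intro internal_direct_sum_slice) auto

lemma V_sum: "internal_direct_sum V (carrier L) W"
  using grading by (intro internal_direct_sum_group finite_K) auto

lemma W_subset: "l \<in> carrier L \<Longrightarrow> W l \<subseteq> V"
  by (rule internal_direct_sum_subset[OF V_sum])

lemma gcomp_W: "x \<in> gcomp H (k, l) \<Longrightarrow> k \<in> carrier K \<Longrightarrow> x \<in> W l"
  by (auto intro: span_base)

lemma gcomps_V: "l \<in> carrier L \<Longrightarrow> (\<Union>k\<in>carrier K. gcomp H (k, l)) \<subseteq> V"
  using gcomp_subset by auto

lemma qcomp_subspace: "subspace (qcomp H r)"
  by (rule internal_direct_sum_subspace[OF rat_grading UNIV_I])

lemma qcomp_subset: "qcomp H r \<subseteq> V"
  by (rule internal_direct_sum_subset[OF rat_grading UNIV_I])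

text \<open>The second coordinate is a homomorphism to \<open>L\<close>, so conjugating a degree
  \<open>(j, l)\<close> by \<open>(k, l')\<close> conjugates \<open>l\<close> by \<open>l'\<close>,
  whatever \<open>j\<close> and \<open>k\<close> are.\<close>

lemma action_W:
  assumes "k \<in> carrier K" "l \<in> carrier L" "l' \<in> carrier L" "x \<in> W l"
  shows "\<rho> (k, l') x \<in> W (inv\<^bsub>L\<^esub> l' \<otimes>\<^bsub>L\<^esub> l \<otimes>\<^bsub>L\<^esub> l')"
proof (rule linear_on_span[OF _ space_subspace gcomps_V _ subspace_span assms(4)])
  have "\<rho> (k, l') y \<in> W (inv\<^bsub>L\<^esub> l' \<otimes>\<^bsub>L\<^esub> l \<otimes>\<^bsub>L\<^esub> l')"
    if "j \<in> carrier K" "y \<in> gcomp H (j, l)" for j y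
  proof -
    have "\<rho> (k, l') y \<in> gcomp H (inv\<^bsub>S\<^esub> (k, l') \<otimes>\<^bsub>S\<^esub> (j, l) \<otimes>\<^bsub>S\<^esub> (k, l'))"
      using assms that by (intro action_grading) auto
    then show ?thesis
      using assms that by (auto simp: inv_S act_closed intro: gcomp_W)
  qed
  then show "\<rho> (k, l') ` (\<Union>k\<in>carrier K. gcomp H (k, l)) \<subseteq> W (inv\<^bsub>L\<^esub> l' \<otimes>\<^bsub>L\<^esub> l \<otimes>\<^bsub>L\<^esub> l')"
    by blast
qed (use assms action_linear in auto)

lemma mult_W:
  assumes l: "l \<in> carrier L" "l' \<in> carrier L" and vw: "v \<in> W l" "w \<in> W l'"
  shows "hmult H v w \<in> W (l \<otimes>\<^bsub>L\<^esub> l')"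
proof -
  \<comment> \<open>Bilinearity is used one factor at a time: homogeneous pairs first, then
    arbitrary \<open>w\<close>, then arbitrary \<open>v\<close>.\<close>
  have 1: "hmult H x y \<in> W (l \<otimes>\<^bsub>L\<^esub> l')"
    if "k \<in> carrier K" "j \<in> carrier K" "x \<in> gcomp H (k, l)" "y \<in> gcomp H (j, l')" for k j x y
  proof -
    have "hmult H x y \<in> gcomp H ((k, l) \<otimes>\<^bsub>S\<^esub> (j, l'))"
      using that l by (intro mult_grading) auto
    then show ?thesis using that l by (auto simp: act_closed intro: gcomp_W)
  qed
  have 2: "hmult H x w \<in> W (l \<otimes>\<^bsub>L\<^esub> l')" if "k \<in> carrier K" "x \<in> gcomp H (k, l)" for k x
  proof (rule linear_on_span[OF _ space_subspace gcomps_V _ subspace_span vw(2)])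
    show "linear_on V (hmult H x)"
      using that l gcomp_subset[of "(k, l)"] by (intro mult_linear_right) auto
  qed (use 1 that l in auto)
  show ?thesis
    by (rule linear_on_span[OF mult_linear_left space_subspace gcomps_V _ subspace_span vw(1)])
      (use 2 l vw W_subset in auto)
qed

section \<open>Averaging over \<open>K\<close> and fixed vectors\<close>

lemma linear_on_proj: "linear_on V proj"
  unfolding coinv_proj_def
  by (intro linear_on_scaled linear_on_sum_fun action_linear) auto

lemma proj_mem:
  assumes "subspace T" "\<And>k. k \<in> carrier K \<Longrightarrow> \<rho> (k, \<one>\<^bsub>L\<^esub>) x \<in> T"
  shows "proj x \<in> T"
  unfolding coinv_proj_def using assms by (intro subspace_scale subspace_sum) auto

lemma K_inv_proj:
  assumes "x \<in> V"
  shows "K_inv (proj x)"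
proof
  fix k assume k: "k \<in> carrier K"
  \<comment> \<open>Acting by \<open>k\<close> after \<open>j\<close> is acting by
    \<open>j k\<close>, and right translation by \<open>k\<close> permutes \<open>K\<close>, so the
    average is only re-indexed.\<close>
  have bij: "bij_betw (\<lambda>j. j \<otimes>\<^bsub>K\<^esub> k) (carrier K) (carrier K)"
    by (rule bij_betwI[where g = "\<lambda>j. j \<otimes>\<^bsub>K\<^esub> inv\<^bsub>K\<^esub> k"]) (use k in \<open>auto simp: K.m_assoc\<close>)
  have "\<rho> (k, \<one>\<^bsub>L\<^esub>) (proj x) = scale c (\<Sum>j\<in>carrier K. \<rho> (k, \<one>\<^bsub>L\<^esub>) (\<rho> (j, \<one>\<^bsub>L\<^esub>) x))"
    using assms k unfolding coinv_proj_def
    by (simp add: linear_on_scale[OF action_linear] linear_on_sum[OF action_linear space_subspace]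
        action_closed space_subspace subspace_sum)
  also have "\<dots> = scale c (\<Sum>j\<in>carrier K. \<rho> (j \<otimes>\<^bsub>K\<^esub> k, \<one>\<^bsub>L\<^esub>) x)"
    using assms k by (simp add: action_mult[symmetric] act_one)
  also have "\<dots> = proj x"
    unfolding coinv_proj_def
    using sum.reindex_bij_betw[OF bij, of "\<lambda>j. \<rho> (j, \<one>\<^bsub>L\<^esub>) x"] by simp
  finally show "\<rho> (k, \<one>\<^bsub>L\<^esub>) (proj x) = proj x" .
qed

lemma proj_K_inv: "K_inv x \<Longrightarrow> proj x = x"
  using card_K by (simp add: coinv_proj_def sum_constant_scale)

lemma act_K_inv:
  assumes "K_inv x" "x \<in> V" "k \<in> carrier K" "l \<in> carrier L"
  shows "\<rho> (k, l) x = \<rho> (\<one>\<^bsub>K\<^esub>, l) x"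
  using action_mult[of "(k, \<one>\<^bsub>L\<^esub>)" "(\<one>\<^bsub>K\<^esub>, l)" x] assms by (simp add: act_one)

lemma act_proj:
  assumes "x \<in> V" "l \<in> carrier L"
  shows "\<rho> (\<one>\<^bsub>K\<^esub>, l) (proj x) = scale c (\<Sum>k\<in>carrier K. \<rho> (k, l) x)"
proof -
  have "\<rho> (\<one>\<^bsub>K\<^esub>, l) (proj x) = scale c (\<Sum>k\<in>carrier K. \<rho> (\<one>\<^bsub>K\<^esub>, l) (\<rho> (k, \<one>\<^bsub>L\<^esub>) x))"
    using assms unfolding coinv_proj_def
    by (simp add: linear_on_scale[OF action_linear] linear_on_sum[OF action_linear space_subspace]
        action_closed space_subspace subspace_sum)
  then show ?thesis
    using assms by (simp add: action_mult[symmetric] act_one)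
qed

text \<open>The average is re-indexed to run over the inverses of \<open>(k, l)\<close>, the form in
  which the trace axiom of \<open>H\<close> uses the action.\<close>

lemma act_proj_inv:
  assumes "x \<in> V" "l \<in> carrier L"
  shows "\<rho> (\<one>\<^bsub>K\<^esub>, inv\<^bsub>L\<^esub> l) (proj x) = scale c (\<Sum>k\<in>carrier K. \<rho> (inv\<^bsub>S\<^esub> (k, l)) x)"
proof -
  have "bij_betw (\<lambda>k. inv\<^bsub>K\<^esub> k) (carrier K) (carrier K)"
    by (rule bij_betwI[where g = "\<lambda>k. inv\<^bsub>K\<^esub> k"]) auto
  then have "bij_betw (\<lambda>k. \<alpha> l (inv\<^bsub>K\<^esub> k)) (carrier K) (carrier K)"
    using bij_betw_trans[OF _ bij_act[OF assms(2)]] by (simp add: comp_def)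
  from sum.reindex_bij_betw[OF this, of "\<lambda>k. \<rho> (k, inv\<^bsub>L\<^esub> l) x"] show ?thesis
    using assms by (simp add: act_proj inv_S)
qed

text \<open>Here \<open>(1, l)(k, 1) = (\<alpha> (l^-1) k, l)\<close>, and
  \<open>\<alpha> (l^-1)\<close> permutes \<open>K\<close>. The sum is the one in
  \<open>act_proj\<close>, so averaging commutes with the action of \<open>L\<close>.\<close>

lemma proj_act:
  assumes "x \<in> V" "l \<in> carrier L"
  shows "proj (\<rho> (\<one>\<^bsub>K\<^esub>, l) x) = scale c (\<Sum>k\<in>carrier K. \<rho> (k, l) x)"
proof -
  have "(\<Sum>k\<in>carrier K. \<rho> (k, \<one>\<^bsub>L\<^esub>) (\<rho> (\<one>\<^bsub>K\<^esub>, l) x)) = (\<Sum>k\<in>carrier K. \<rho> (\<alpha> (inv\<^bsub>L\<^esub> l) k, l) x)"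
    using assms by (simp add: action_mult[symmetric] act_closed)
  also have "\<dots> = (\<Sum>k\<in>carrier K. \<rho> (k, l) x)"
    using sum.reindex_bij_betw[OF bij_act, of "inv\<^bsub>L\<^esub> l" "\<lambda>k. \<rho> (k, l) x"] assms by simp
  finally show ?thesis by (simp add: coinv_proj_def)
qed

lemma K_inv_act:
  assumes "K_inv x" "x \<in> V" "l \<in> carrier L"
  shows "K_inv (\<rho> (\<one>\<^bsub>K\<^esub>, l) x)"
proof -
  have "\<rho> (\<one>\<^bsub>K\<^esub>, l) x = proj (\<rho> (\<one>\<^bsub>K\<^esub>, l) x)"
    using assms act_proj[of x l] proj_act[of x l] by (simp add: proj_K_inv)
  then show ?thesis
    using K_inv_proj[of "\<rho> (\<one>\<^bsub>K\<^esub>, l) x"] assms action_closed by simp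
qed

lemma K_inv_mult:
  assumes "K_inv x" "K_inv y" "x \<in> V" "y \<in> V"
  shows "K_inv (hmult H x y)"
  using assms by (auto simp: mult_equivariant[symmetric])

text \<open>Averaging stays inside a \<open>K\<close>-stable subspace and fixes its fixed vectors.
  This identifies the images of the whole space, of \<open>W l\<close>, of the rational components
  and of their intersections with \<open>W l\<close>.\<close>

lemma proj_image:
  assumes "T \<subseteq> V" "subspace T" "\<And>k x. k \<in> carrier K \<Longrightarrow> x \<in> T \<Longrightarrow> \<rho> (k, \<one>\<^bsub>L\<^esub>) x \<in> T"
  shows "proj ` T = {x \<in> T. K_inv x}"
proof
  show "proj ` T \<subseteq> {x \<in> T. K_inv x}"
    using K_inv_proj proj_mem[OF assms(2)] assms(1,3) by blast
  show "{x \<in> T. K_inv x} \<subseteq> proj ` T"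
    using proj_K_inv by force
qed

lemma proj_V: "proj ` V = {x \<in> V. K_inv x}"
  by (intro proj_image) (auto simp: space_subspace action_closed)

lemma proj_W: "l \<in> carrier L \<Longrightarrow> proj ` W l = {x \<in> W l. K_inv x}"
  using action_W[of _ l "\<one>\<^bsub>L\<^esub>"] by (intro proj_image W_subset) auto

lemma proj_qcomp: "proj ` qcomp H r = {x \<in> qcomp H r. K_inv x}"
  using rat_grading_action by (intro proj_image qcomp_subset qcomp_subspace) auto

section \<open>Twisted commutativity and self-invariance\<close>

text \<open>For a component of \<open>v\<close> of degree \<open>(k, m)\<close> the axiom of
  \<open>H\<close> acts on \<open>w\<close> by the inverse of \<open>(k, m)\<close>. As
  \<open>w\<close> is fixed by \<open>K\<close>, the result depends on \<open>m\<close> alone, and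
  the identities for all \<open>k\<close> add up.\<close>

lemma twisted_comm:
  assumes m: "m \<in> carrier L" and n: "n \<in> carrier L" and v: "v \<in> W m" and w: "w \<in> W n" "K_inv w"
  shows "hmult H v w = hmult H (\<rho> (\<one>\<^bsub>K\<^esub>, inv\<^bsub>L\<^esub> m) w) v"
proof -
  have V: "v \<in> V" "w \<in> V" using v w W_subset m n by auto
  have gen: "hmult H x w = hmult H (\<rho> (\<one>\<^bsub>K\<^esub>, inv\<^bsub>L\<^esub> m) w) x"
    if k: "k \<in> carrier K" and x: "x \<in> gcomp H (k, m)" for k x
  proof -
    have xV: "x \<in> V" using gcomp_subset[of "(k, m)"] k x m by auto
    have inv: "inv\<^bsub>S\<^esub> (k, m) \<in> carrier S" using k m by (intro inv_closed) simp
    have "hmult H x w = hmult H (\<rho> (inv\<^bsub>S\<^esub> (k, m)) w) x"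
    proof (rule linear_on_eq_span[OF _ _ space_subspace gcomps_V[OF n] _ w(1)])
      show "linear_on V (hmult H x)" by (rule mult_linear_right[OF xV])
      show "linear_on V (\<lambda>y. hmult H (\<rho> (inv\<^bsub>S\<^esub> (k, m)) y) x)"
        by (rule linear_on_compose[OF action_linear[OF inv] mult_linear_left[OF xV]])
          (rule action_closed[OF inv])
      show "hmult H x y = hmult H (\<rho> (inv\<^bsub>S\<^esub> (k, m)) y) x"
        if "y \<in> (\<Union>j\<in>carrier K. gcomp H (j, n))" for y
        using that mult_twisted_comm[of "(k, m)" _ x y] k m n x by auto
    qed
    also have "\<rho> (inv\<^bsub>S\<^esub> (k, m)) w = \<rho> (\<one>\<^bsub>K\<^esub>, inv\<^bsub>L\<^esub> m) w"
      using act_K_inv[OF w(2) V(2), of "\<alpha> m (inv\<^bsub>K\<^esub> k)" "inv\<^bsub>L\<^esub> m"] k m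
      by (simp add: inv_S act_closed)
    finally show ?thesis .
  qed
  show ?thesis
  proof (rule linear_on_eq_span[OF _ _ space_subspace gcomps_V[OF m] _ v])
    show "linear_on V (\<lambda>v. hmult H v w)" by (rule mult_linear_left[OF V(2)])
    show "linear_on V (hmult H (\<rho> (\<one>\<^bsub>K\<^esub>, inv\<^bsub>L\<^esub> m) w))"
      using V m by (intro mult_linear_right action_closed) auto
  qed (use gen in auto)
qed

lemma self_invariant_proj:
  assumes l: "l \<in> carrier L" and v: "v \<in> W l" "K_inv v"
  shows "\<rho> (\<one>\<^bsub>K\<^esub>, l) v = v"
proof -
  \<comment> \<open>The components of \<open>v\<close> need not be fixed by \<open>K\<close>. The
    identity is therefore proved for averages, where it can be checked component by
    component.\<close>
  have "\<rho> (\<one>\<^bsub>K\<^esub>, l) (proj v) = proj v"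
  proof (rule linear_on_eq_span[OF _ linear_on_proj space_subspace gcomps_V[OF l] _ v(1)])
    show "linear_on V (\<lambda>x. \<rho> (\<one>\<^bsub>K\<^esub>, l) (proj x))"
      using l proj_V by (intro linear_on_compose[OF linear_on_proj] action_linear) auto
    fix x assume "x \<in> (\<Union>k\<in>carrier K. gcomp H (k, l))"
    then obtain k where k: "k \<in> carrier K" "x \<in> gcomp H (k, l)" by auto
    have xV: "x \<in> V" using gcomp_subset[of "(k, l)"] k l by auto
    have "bij_betw (\<lambda>j. k \<otimes>\<^bsub>K\<^esub> j) (carrier K) (carrier K)"
      by (rule bij_betwI[where g = "\<lambda>j. inv\<^bsub>K\<^esub> k \<otimes>\<^bsub>K\<^esub> j"])
        (use k in \<open>auto simp: K.m_assoc[symmetric]\<close>)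
    then have bij: "bij_betw (\<lambda>j. k \<otimes>\<^bsub>K\<^esub> \<alpha> (inv\<^bsub>L\<^esub> l) j) (carrier K) (carrier K)"
      using bij_betw_trans[OF bij_act, of "inv\<^bsub>L\<^esub> l"] l by (simp add: comp_def)
    \<comment> \<open>\<open>x\<close> has degree \<open>(k, l)\<close> and is fixed by
      \<open>(k, l)\<close>. Inserting that action before \<open>(j, 1)\<close> turns the average
      over \<open>K\<close> into an average over the coset of all \<open>(i, l)\<close>.\<close>
    have "\<rho> (j, \<one>\<^bsub>L\<^esub>) x = \<rho> (k \<otimes>\<^bsub>K\<^esub> \<alpha> (inv\<^bsub>L\<^esub> l) j, l) x" if "j \<in> carrier K" for j
      using action_mult[of "(k, l)" "(j, \<one>\<^bsub>L\<^esub>)" x] self_invariant[of "(k, l)" x] k l that xV by simp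
    then have "proj x = scale c (\<Sum>j\<in>carrier K. \<rho> (k \<otimes>\<^bsub>K\<^esub> \<alpha> (inv\<^bsub>L\<^esub> l) j, l) x)"
      by (simp add: coinv_proj_def)
    also have "\<dots> = \<rho> (\<one>\<^bsub>K\<^esub>, l) (proj x)"
      using sum.reindex_bij_betw[OF bij, of "\<lambda>j. \<rho> (j, l) x"] by (simp add: act_proj[OF xV l])
    finally show "\<rho> (\<one>\<^bsub>K\<^esub>, l) (proj x) = proj x" ..
  qed
  then show ?thesis using v by (simp add: proj_K_inv)
qed

section \<open>The metric\<close>

lemma subspace_metric_null:
  assumes "w \<in> V"
  shows "subspace {v \<in> V. metric H v w = 0}"
  using assms space_subspace metric_scale[of 0 w 0]
  by (auto simp: subspace_def metric_add metric_scale)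

lemma metric_W:
  assumes "m \<in> carrier L" "n \<in> carrier L" "v \<in> W m" "w \<in> W n" "metric H v w \<noteq> 0"
  shows "m \<otimes>\<^bsub>L\<^esub> n = \<one>\<^bsub>L\<^esub>"
proof (rule ccontr)
  assume ne: "m \<otimes>\<^bsub>L\<^esub> n \<noteq> \<one>\<^bsub>L\<^esub>"
  have V: "v \<in> V" "w \<in> V" using assms W_subset by auto
  have 1: "metric H x y = 0"
    if "k \<in> carrier K" "j \<in> carrier K" "x \<in> gcomp H (k, m)" "y \<in> gcomp H (j, n)" for k j x y
    using metric_grading[of "(k, m)" "(j, n)" x y] that assms(1,2) ne by auto
  have 2: "metric H x w = 0" if "k \<in> carrier K" "x \<in> gcomp H (k, m)" for k x
  proof -
    have x: "x \<in> V" using gcomp_subset[of "(k, m)"] that assms(1) by auto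
    \<comment> \<open>Orthogonality to \<open>x\<close> is a subspace condition on the first
      argument; symmetry lets the second argument range over a span too.\<close>
    have "W n \<subseteq> {y \<in> V. metric H y x = 0}"
    proof (rule span_minimal[OF subsetI subspace_metric_null[OF x]])
      fix y assume "y \<in> (\<Union>j\<in>carrier K. gcomp H (j, n))"
      then obtain j where j: "j \<in> carrier K" "y \<in> gcomp H (j, n)" by auto
      then have "y \<in> V" using gcomp_subset[of "(j, n)"] assms(2) by auto
      then show "y \<in> {y \<in> V. metric H y x = 0}"
        using 1[OF that(1) j(1) that(2) j(2)] metric_sym[OF x] by simp
    qed
    then show ?thesis using assms(4) metric_sym[OF x V(2)] by auto
  qed
  have "W m \<subseteq> {y \<in> V. metric H y w = 0}"
    using 2 gcomps_V[OF assms(1)] by (intro span_minimal[OF _ subspace_metric_null[OF V(2)]]) auto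
  then show False using assms(3,5) by auto
qed

lemma metric_sum:
  assumes "finite I" "\<And>i. i \<in> I \<Longrightarrow> x i \<in> V" "w \<in> V"
  shows "metric H (\<Sum>i\<in>I. x i) w = (\<Sum>i\<in>I. metric H (x i) w)"
  using assms(1,2)
proof induction
  case empty
  then show ?case using metric_scale[of 0 w 0] assms(3) space_subspace by (simp add: subspace_0)
next
  case (insert i I)
  then show ?case
    using assms(3) by (simp add: metric_add subspace_sum[OF space_subspace])
qed

text \<open>As \<open>w\<close> is fixed by \<open>K\<close>, replacing it by its image under
  \<open>k\<close> and using invariance shows that every term of the average equals
  \<open>metric H v w\<close>. This is what carries non-degeneracy over to the fixed
  vectors.\<close>

lemma metric_proj:
  assumes "v \<in> V" "w \<in> V" "K_inv w"
  shows "metric H (proj v) w = metric H v w"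
proof -
  have "metric H (proj v) w = c * (\<Sum>k\<in>carrier K. metric H (\<rho> (k, \<one>\<^bsub>L\<^esub>) v) w)"
    using assms unfolding coinv_proj_def
    by (simp add: metric_scale metric_sum finite_K action_closed subspace_sum[OF space_subspace])
  also have "\<dots> = c * (\<Sum>k\<in>carrier K. metric H v w)"
    using assms metric_invariant[of "(_, \<one>\<^bsub>L\<^esub>)" v w] by simp
  finally show ?thesis using card_K by simp
qed

section \<open>The two gradings of the fixed vectors\<close>

lemma W_rat_sum:
  assumes l: "l \<in> carrier L"
  shows "internal_direct_sum (W l) UNIV (\<lambda>r. W l \<inter> qcomp H r)"
proof (rule internal_direct_sum_smaller[OF rat_grading])
  show "subspace (W l \<inter> qcomp H r)" for r
    by (intro subspace_inter subspace_span qcomp_subspace)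
  show "W l = span (\<Union>r. W l \<inter> qcomp H r)"
  proof
    show "span (\<Union>r. W l \<inter> qcomp H r) \<subseteq> W l"
      by (intro span_minimal subspace_span) auto
    \<comment> \<open>Compatibility of the rational grading with each single \<open>gcomp\<close>
      gives spanning; independence is inherited from the grading of the whole space.\<close>
    have "gcomp H (k, l) \<subseteq> span (\<Union>r. W l \<inter> qcomp H r)" if "k \<in> carrier K" for k
    proof -
      have "gcomp H (k, l) = span (\<Union>r. gcomp H (k, l) \<inter> qcomp H r)"
        using internal_direct_sum_span[OF rat_grading_group, of "(k, l)"] that l by simp
      also have "\<dots> \<subseteq> span (\<Union>r. W l \<inter> qcomp H r)"
        using that by (intro span_mono UN_mono Int_mono) (auto intro: gcomp_W)
      finally show ?thesis .
    qed
    then show "W l \<subseteq> span (\<Union>r. W l \<inter> qcomp H r)"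
      by (intro span_minimal subspace_span) auto
  qed
qed auto

lemma K_inv_W_rat_sum:
  assumes l: "l \<in> carrier L"
  shows "internal_direct_sum (proj ` W l) UNIV (\<lambda>r. proj ` W l \<inter> proj ` qcomp H r)"
proof -
  \<comment> \<open>Images under a linear map need not commute with intersections; here both sides
    are the \<open>K\<close>-fixed vectors of \<open>W l \<inter> qcomp H r\<close>.\<close>
  have img: "proj ` (W l \<inter> qcomp H r) = proj ` W l \<inter> proj ` qcomp H r" for r
  proof -
    have "proj ` (W l \<inter> qcomp H r) = {x \<in> W l \<inter> qcomp H r. K_inv x}"
      using W_subset[OF l] action_W[of _ l "\<one>\<^bsub>L\<^esub>"] rat_grading_action l
      by (intro proj_image subspace_inter subspace_span qcomp_subspace) auto
    then show ?thesis by (auto simp: proj_W[OF l] proj_qcomp)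
  qed
  have "internal_direct_sum (proj ` W l) UNIV (\<lambda>r. proj ` (W l \<inter> qcomp H r))"
  proof (rule internal_direct_sum_image[OF W_rat_sum[OF l]])
    show "linear_on (W l) proj" by (rule linear_on_subset[OF linear_on_proj W_subset[OF l]])
    show "proj ` (W l \<inter> qcomp H r) \<subseteq> W l \<inter> qcomp H r" for r
      unfolding img by (auto simp: proj_W[OF l] proj_qcomp)
  qed
  then show ?thesis by (simp add: img)
qed

lemma K_inv_V_sum: "internal_direct_sum (proj ` V) (carrier L) (\<lambda>l. proj ` W l)"
  by (rule internal_direct_sum_image[OF V_sum linear_on_proj]) (auto simp: proj_W)

lemma K_inv_rat_sum: "internal_direct_sum (proj ` V) UNIV (\<lambda>r. proj ` qcomp H r)"
  by (rule internal_direct_sum_image[OF rat_grading linear_on_proj]) (auto simp: proj_qcomp)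

section \<open>The trace axiom\<close>

lemma finite_dim_V: obtains C where "finite C" "span C = V"
  using space_finite_dim by auto

text \<open>A map sending \<open>W l\<close> into the fixed vectors has its whole trace there. On
  \<open>W l\<close> the decomposition into the \<open>gcomp H (k, l)\<close> becomes
  available.\<close>

lemma trace_K_inv:
  assumes l: "l \<in> carrier L" and f: "linear_on V f" "\<And>x. x \<in> W l \<Longrightarrow> f x \<in> proj ` W l"
  shows "trace_on (proj ` W l) f = trace_on (W l) f"
proof -
  obtain C where C: "finite C" "span C = V" by (rule finite_dim_V)
  have "trace_on (W l) f = (\<Sum>i\<in>{()}. trace_on (proj ` W l) f)"
  proof (rule trace_on_sum[OF C(1)])
    show "subspace (proj ` W l)"
      by (rule internal_direct_sum_subspace[OF K_inv_V_sum l])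
    show "linear_on (W l) f" by (rule linear_on_subset[OF f(1) W_subset[OF l]])
  qed (use W_subset[OF l] C(2) f(2) proj_W[OF l] in auto)
  then show ?thesis by simp
qed

text \<open>The last hypothesis says that \<open>h j k\<close> is the diagonal block of \<open>g j\<close> at \<open>H\<^bsub>kl\<^esub>\<close>: on that
  component \<open>g j\<close> is a sum of homogeneous terms, exactly one of which has degree \<open>kl\<close>.\<close>

lemma trace_W:
  assumes l: "l \<in> carrier L" and J: "finite J"
    and g: "\<And>j. j \<in> J \<Longrightarrow> linear_on V (g j)" "\<And>j x. j \<in> J \<Longrightarrow> x \<in> W l \<Longrightarrow> g j x \<in> W l"
    and f: "\<And>x. x \<in> W l \<Longrightarrow> f x = (\<Sum>j\<in>J. g j x)"
    and h: "\<And>j k x. j \<in> J \<Longrightarrow> k \<in> carrier K \<Longrightarrow> x \<in> gcomp H (k, l) \<Longrightarrow>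
      \<exists>i0\<in>carrier K. \<exists>t e. g j x = (\<Sum>i\<in>carrier K. t i) \<and> h j k x = t i0 \<and>
        (\<forall>i\<in>carrier K. e i \<in> carrier K \<and> t i \<in> gcomp H (e i, l) \<and> (e i = k \<longleftrightarrow> i = i0))"
  shows "trace_on (W l) f = (\<Sum>j\<in>J. \<Sum>k\<in>carrier K. trace_on (gcomp H (k, l)) (h j k))"
proof -
  obtain C where C: "finite C" "span C = V" by (rule finite_dim_V)
  obtain p where p: "\<And>k. k \<in> carrier K \<Longrightarrow> linear_on (W l) (p k)"
    "\<And>k x. k \<in> carrier K \<Longrightarrow> x \<in> W l \<Longrightarrow> p k x \<in> gcomp H (k, l)"
    "\<And>x. x \<in> W l \<Longrightarrow> x = (\<Sum>k\<in>carrier K. p k x)"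
    "\<And>k j x. k \<in> carrier K \<Longrightarrow> j \<in> carrier K \<Longrightarrow> x \<in> gcomp H (j, l) \<Longrightarrow>
      p k x = (if k = j then x else 0)"
    using internal_direct_sum_projections[OF W_sum[OF l] finite_K] by blast
  \<comment> \<open>The map \<open>p k\<close> after \<open>g j\<close> takes values in
    \<open>gcomp H (k, l)\<close>, so its trace is that of its restriction there, a diagonal
    block.\<close>
  have "trace_on (W l) f =
      (\<Sum>(j, k)\<in>J \<times> carrier K. trace_on (gcomp H (k, l)) (\<lambda>x. p k (g j x)))"
    unfolding case_prod_unfold
  proof (rule trace_on_sum[OF C(1)])
    fix i assume "i \<in> J \<times> carrier K"
    then have i: "fst i \<in> J" "snd i \<in> carrier K" by auto
    show "linear_on (W l) (\<lambda>x. p (snd i) (g (fst i) x))"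
      using linear_on_subset[OF g(1)[OF i(1)] W_subset[OF l]] p(1)[OF i(2)] g(2)[OF i(1)]
      by (rule linear_on_compose)
    show "p (snd i) (g (fst i) x) \<in> gcomp H (snd i, l)" if "x \<in> W l" for x
      using p(2) g(2) i that by blast
    show "subspace (gcomp H (snd i, l))" using i l by (intro gcomp_subspace) auto
    show "gcomp H (snd i, l) \<subseteq> W l" using i gcomp_W by blast
  next
    fix x assume x: "x \<in> W l"
    have "f x = (\<Sum>j\<in>J. \<Sum>k\<in>carrier K. p k (g j x))"
      unfolding f[OF x] using p(3)[OF g(2)[OF _ x]] by (rule sum.cong[OF refl])
    then show "f x = (\<Sum>i\<in>J \<times> carrier K. p (snd i) (g (fst i) x))"
      by (simp add: sum.cartesian_product case_prod_unfold)
  qed (use W_subset[OF l] C(2) in auto)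
  moreover have "trace_on (gcomp H (k, l)) (\<lambda>x. p k (g j x)) = trace_on (gcomp H (k, l)) (h j k)"
    if j: "j \<in> J" and k: "k \<in> carrier K" for j k
  proof (rule trace_on_cong[OF C(1)])
    show "gcomp H (k, l) \<subseteq> span C" using gcomp_subset[of "(k, l)"] C k l by simp
    show "subspace (gcomp H (k, l))" using k l by (intro gcomp_subspace) auto
    fix x assume "x \<in> gcomp H (k, l)"
    from h[OF j k this] obtain i0 t e where i0: "i0 \<in> carrier K"
      and t: "g j x = (\<Sum>i\<in>carrier K. t i)" "h j k x = t i0"
      and e: "\<And>i. i \<in> carrier K \<Longrightarrow> e i \<in> carrier K"
        "\<And>i. i \<in> carrier K \<Longrightarrow> t i \<in> gcomp H (e i, l)"
        "\<And>i. i \<in> carrier K \<Longrightarrow> e i = k \<longleftrightarrow> i = i0"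
      by blast
    have "p k (g j x) = (\<Sum>i\<in>carrier K. p k (t i))"
      unfolding t(1)
      by (rule linear_on_sum[OF p(1)[OF k] subspace_span]) (use e(1,2) in \<open>auto intro: gcomp_W\<close>)
    \<comment> \<open>\<open>p k\<close> annihilates every term of degree other than
      \<open>(k, l)\<close>; by the condition on \<open>e\<close> only \<open>t i0\<close>
      survives.\<close>
    also have "\<dots> = (\<Sum>i\<in>carrier K. if i = i0 then t i else 0)"
    proof (intro sum.cong refl)
      fix i assume i: "i \<in> carrier K"
      then show "p k (t i) = (if i = i0 then t i else 0)"
        using p(4)[OF k e(1)[OF i] e(2)[OF i]] e(3)[OF i] by simp metis
    qed
    also have "\<dots> = h j k x" using i0 finite_K t(2) by (simp add: sum.delta)
    finally show "p k (g j x) = h j k x" .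
  qed
  ultimately show ?thesis by (simp add: sum.cartesian_product[symmetric])
qed

lemma snd_mult_S: "snd (x \<otimes>\<^bsub>S\<^esub> y) = snd x \<otimes>\<^bsub>L\<^esub> snd y"
  by (cases x, cases y) simp

lemma snd_inv_S: "x \<in> carrier S \<Longrightarrow> snd (inv\<^bsub>S\<^esub> x) = inv\<^bsub>L\<^esub> snd x"
  by (cases x) (simp add: inv_S)

lemma trace_axiom_K_inv:
  assumes a: "a \<in> carrier L" and b: "b \<in> carrier L"
    and v: "v \<in> W (a \<otimes>\<^bsub>L\<^esub> b \<otimes>\<^bsub>L\<^esub> inv\<^bsub>L\<^esub> a \<otimes>\<^bsub>L\<^esub> inv\<^bsub>L\<^esub> b)" "K_inv v"
  shows "trace_on (proj ` W a) (\<lambda>x. hmult H v (\<rho> (\<one>\<^bsub>K\<^esub>, inv\<^bsub>L\<^esub> b) x)) =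
    trace_on (proj ` W b) (\<lambda>x. \<rho> (\<one>\<^bsub>K\<^esub>, a) (hmult H v x))"
proof -
  define m where "m = a \<otimes>\<^bsub>L\<^esub> b \<otimes>\<^bsub>L\<^esub> inv\<^bsub>L\<^esub> a \<otimes>\<^bsub>L\<^esub> inv\<^bsub>L\<^esub> b"
  have m: "m \<in> carrier L" using a b by (simp add: m_def)
  have ma: "m \<otimes>\<^bsub>L\<^esub> (b \<otimes>\<^bsub>L\<^esub> a \<otimes>\<^bsub>L\<^esub> inv\<^bsub>L\<^esub> b) = a"
    using L.mult_conj_eq_iff[OF m a b] by (simp add: m_def)
  have mb: "inv\<^bsub>L\<^esub> a \<otimes>\<^bsub>L\<^esub> (m \<otimes>\<^bsub>L\<^esub> b) \<otimes>\<^bsub>L\<^esub> a = b"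
    using L.conj_mult_eq_iff[OF m a b] by (simp add: m_def)
  have vW: "v \<in> W m" using v(1) by (simp add: m_def)
  have vV: "v \<in> V" using vW W_subset[OF m] by auto
  have "\<exists>u. (\<forall>i\<in>carrier K. u i \<in> gcomp H (i, m)) \<and> v = (\<Sum>i\<in>carrier K. u i)"
    by (rule span_UN_finite[OF finite_K _ vW]) (use m gcomp_subspace in auto)
  then obtain u where u: "\<And>i. i \<in> carrier K \<Longrightarrow> u i \<in> gcomp H (i, m)" "v = (\<Sum>i\<in>carrier K. u i)"
    by blast
  have uV: "u i \<in> V" if "i \<in> carrier K" for i
    using u(1)[OF that] gcomp_subset[of "(i, m)"] that m by auto
  have v_mult: "hmult H v x = (\<Sum>i\<in>carrier K. hmult H (u i) x)" if "x \<in> V" for x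
    unfolding u(2) by (rule linear_on_sum[OF mult_linear_left[OF that] space_subspace]) (rule uV)
  \<comment> \<open>The commutator of \<open>(k, a)\<close> and \<open>(j, b)\<close>. Its
    \<open>L\<close>-part is always \<open>m\<close>, so its \<open>K\<close>-part indexes a
    component of \<open>v\<close>.\<close>
  define w where "w k j = (k, a) \<otimes>\<^bsub>S\<^esub> (j, b) \<otimes>\<^bsub>S\<^esub> inv\<^bsub>S\<^esub> (k, a) \<otimes>\<^bsub>S\<^esub> inv\<^bsub>S\<^esub> (j, b)" for k j
  have w: "fst (w k j) \<in> carrier K" "w k j = (fst (w k j), m)"
    if kj: "k \<in> carrier K" "j \<in> carrier K" for k j
  proof -
    have mem: "(k, a) \<in> carrier S" "(j, b) \<in> carrier S" using kj a b by auto
    then have "w k j \<in> carrier S" unfolding w_def by (intro m_closed inv_closed)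
    moreover have "snd (w k j) = m"
      using mem by (simp add: w_def snd_mult_S snd_inv_S m_def del: mult_S carrier_S)
    ultimately show "fst (w k j) \<in> carrier K" "w k j = (fst (w k j), m)" by auto
  qed
  \<comment> \<open>The component of \<open>v\<close> in degree \<open>w k j\<close>, with the
    averaging factor \<open>c\<close> absorbed so that the trace axiom of \<open>H\<close> applies
    to it directly.\<close>
  let ?u = "\<lambda>k j. scale c (u (fst (w k j)))"
  have mul_scale: "scale c (hmult H x y) = hmult H (scale c x) y" if "x \<in> V" "y \<in> V" for x y
    using linear_on_scale[OF mult_linear_left[OF that(2)] that(1)] by simp
  obtain C where C: "finite C" "span C = V" by (rule finite_dim_V)
  have sub: "subspace (proj ` W l)" "proj ` W l \<subseteq> span C" if "l \<in> carrier L" for l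
    using internal_direct_sum_subspace[OF K_inv_V_sum that]
      internal_direct_sum_subset[OF K_inv_V_sum that] proj_V C by auto

  \<comment> \<open>On fixed vectors \<open>proj\<close> may be inserted freely. With it the map
    sends all of \<open>W a\<close> into the fixed vectors, as \<open>trace_K_inv\<close>
    requires.\<close>
  have "trace_on (proj ` W a) (\<lambda>x. hmult H v (\<rho> (\<one>\<^bsub>K\<^esub>, inv\<^bsub>L\<^esub> b) x)) =
      trace_on (proj ` W a) (\<lambda>x. hmult H v (\<rho> (\<one>\<^bsub>K\<^esub>, inv\<^bsub>L\<^esub> b) (proj x)))"
    using a by (intro trace_on_cong[OF C(1)] sub) (auto simp: proj_W proj_K_inv)
  also have "\<dots> = trace_on (W a) (\<lambda>x. hmult H v (\<rho> (\<one>\<^bsub>K\<^esub>, inv\<^bsub>L\<^esub> b) (proj x)))"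
  proof (rule trace_K_inv[OF a])
    have "linear_on V (\<lambda>x. \<rho> (\<one>\<^bsub>K\<^esub>, inv\<^bsub>L\<^esub> b) (proj x))"
      using b proj_V by (intro linear_on_compose[OF linear_on_proj] action_linear) auto
    then show "linear_on V (\<lambda>x. hmult H v (\<rho> (\<one>\<^bsub>K\<^esub>, inv\<^bsub>L\<^esub> b) (proj x)))"
      using b proj_V by (intro linear_on_compose[OF _ mult_linear_right[OF vV]] action_closed) auto
    fix x assume "x \<in> W a"
    then have px: "proj x \<in> W a" "K_inv (proj x)" using proj_W[OF a] by blast+
    then have pV: "proj x \<in> V" using W_subset[OF a] by auto
    have "\<rho> (\<one>\<^bsub>K\<^esub>, inv\<^bsub>L\<^esub> b) (proj x) \<in> W (b \<otimes>\<^bsub>L\<^esub> a \<otimes>\<^bsub>L\<^esub> inv\<^bsub>L\<^esub> b)"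
      using action_W[of "\<one>\<^bsub>K\<^esub>" a "inv\<^bsub>L\<^esub> b" "proj x"] px a b by simp
    then have "hmult H v (\<rho> (\<one>\<^bsub>K\<^esub>, inv\<^bsub>L\<^esub> b) (proj x)) \<in> W a"
      using mult_W[OF m _ vW] a b ma by (metis L.inv_closed L.m_closed)
    moreover have "K_inv (hmult H v (\<rho> (\<one>\<^bsub>K\<^esub>, inv\<^bsub>L\<^esub> b) (proj x)))"
      using v(2) vV px(2) pV b by (intro K_inv_mult K_inv_act action_closed) auto
    ultimately show "hmult H v (\<rho> (\<one>\<^bsub>K\<^esub>, inv\<^bsub>L\<^esub> b) (proj x)) \<in> proj ` W a"
      by (simp add: proj_W[OF a])
  qed
  \<comment> \<open>By \<open>act_proj_inv\<close> the map is \<open>c\<close> times the sum over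
    \<open>j\<close> of the action of the inverse of \<open>(j, b)\<close> followed by
    multiplication by \<open>v\<close>.\<close>
  also have "\<dots> = (\<Sum>j\<in>carrier K. \<Sum>k\<in>carrier K.
      trace_on (gcomp H (k, a)) (\<lambda>x. hmult H (?u k j) (\<rho> (inv\<^bsub>S\<^esub> (j, b)) x)))"
  proof (rule trace_W[OF a finite_K])
    fix j assume j: "j \<in> carrier K"
    let ?g = "\<lambda>x. scale c (hmult H v (\<rho> (inv\<^bsub>S\<^esub> (j, b)) x))"
    have jb: "inv\<^bsub>S\<^esub> (j, b) \<in> carrier S" using j b by (intro inv_closed) simp
    show "linear_on V ?g"
      by (intro linear_on_scaled linear_on_compose[OF action_linear[OF jb] mult_linear_right[OF vV]]
          action_closed[OF jb])
    {
      fix x assume x: "x \<in> W a"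
      have "\<rho> (inv\<^bsub>S\<^esub> (j, b)) x \<in> W (b \<otimes>\<^bsub>L\<^esub> a \<otimes>\<^bsub>L\<^esub> inv\<^bsub>L\<^esub> b)"
        using action_W[of "\<alpha> b (inv\<^bsub>K\<^esub> j)" a "inv\<^bsub>L\<^esub> b" x] x j a b by (simp add: inv_S act_closed)
      then have "hmult H v (\<rho> (inv\<^bsub>S\<^esub> (j, b)) x) \<in> W a"
        using mult_W[OF m _ vW] a b ma by (metis L.inv_closed L.m_closed)
      then show "?g x \<in> W a" by (intro subspace_scale subspace_span)
    }
    fix k x assume k: "k \<in> carrier K" and x: "x \<in> gcomp H (k, a)"
    \<comment> \<open>\<open>?q\<close> is the degree of \<open>x\<close> after the action, so
      \<open>?e i\<close> is the \<open>K\<close>-part of the degree of \<open>?t i\<close>. It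
      equals \<open>k\<close> exactly when \<open>(i, m)\<close> is the commutator
      \<open>w k j\<close>.\<close>
    let ?q = "(j, b) \<otimes>\<^bsub>S\<^esub> (k, a) \<otimes>\<^bsub>S\<^esub> inv\<^bsub>S\<^esub> (j, b)"
    let ?t = "\<lambda>i. scale c (hmult H (u i) (\<rho> (inv\<^bsub>S\<^esub> (j, b)) x))"
    let ?e = "\<lambda>i. fst ((i, m) \<otimes>\<^bsub>S\<^esub> ?q)"
    have mem: "(k, a) \<in> carrier S" "(j, b) \<in> carrier S" using k j a b by auto
    have q: "?q \<in> carrier S" using mem by (intro m_closed inv_closed)
    have xq: "\<rho> (inv\<^bsub>S\<^esub> (j, b)) x \<in> gcomp H ?q"
      using action_grading[OF jb mem(1) x] mem by (simp del: mult_S carrier_S)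
    then have xV: "\<rho> (inv\<^bsub>S\<^esub> (j, b)) x \<in> V" using gcomp_subset[OF q] by auto
    have snd_q: "snd ((i, m) \<otimes>\<^bsub>S\<^esub> ?q) = a" for i
      using mem ma by (simp add: snd_mult_S snd_inv_S del: mult_S carrier_S)
    show "\<exists>i0\<in>carrier K. \<exists>t e. ?g x = (\<Sum>i\<in>carrier K. t i) \<and>
        hmult H (?u k j) (\<rho> (inv\<^bsub>S\<^esub> (j, b)) x) = t i0 \<and>
        (\<forall>i\<in>carrier K. e i \<in> carrier K \<and> t i \<in> gcomp H (e i, a) \<and> (e i = k \<longleftrightarrow> i = i0))"
    proof (rule bexI[OF _ w(1)[OF k j]], rule exI[of _ ?t], rule exI[of _ ?e], intro conjI ballI)
      show "?g x = (\<Sum>i\<in>carrier K. ?t i)"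
        by (simp add: v_mult[OF xV] scale_sum_right)
      show "hmult H (?u k j) (\<rho> (inv\<^bsub>S\<^esub> (j, b)) x) = ?t (fst (w k j))"
        by (rule mul_scale[symmetric, OF uV[OF w(1)[OF k j]] xV])
      fix i assume i: "i \<in> carrier K"
      have im: "(i, m) \<in> carrier S" using i m by simp
      have iq: "(i, m) \<otimes>\<^bsub>S\<^esub> ?q \<in> carrier S" by (rule m_closed[OF im q])
      then show "?e i \<in> carrier K" by auto
      have eq: "(i, m) \<otimes>\<^bsub>S\<^esub> ?q = (?e i, a)" using snd_q[of i] by (metis prod.collapse)
      have "?t i \<in> gcomp H ((i, m) \<otimes>\<^bsub>S\<^esub> ?q)"
        by (rule subspace_scale[OF gcomp_subspace[OF iq] mult_grading[OF im q u(1)[OF i] xq]])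
      then show "?t i \<in> gcomp H (?e i, a)" using eq by metis
      have "?e i = k \<longleftrightarrow> (i, m) \<otimes>\<^bsub>S\<^esub> ?q = (k, a)" using eq by (metis fst_conv)
      also have "\<dots> \<longleftrightarrow> (i, m) = w k j"
        unfolding w_def by (rule mult_conj_eq_iff[OF im mem])
      also have "\<dots> \<longleftrightarrow> i = fst (w k j)" using w(2)[OF k j] by (metis fst_conv)
      finally show "?e i = k \<longleftrightarrow> i = fst (w k j)" .
    qed
  next
    fix x assume x: "x \<in> W a"
    then have xV: "x \<in> V" using W_subset[OF a] by auto
    have act: "\<rho> (inv\<^bsub>S\<^esub> (j, b)) x \<in> V" if "j \<in> carrier K" for j
      using that b xV by (intro action_closed inv_closed) auto
    show "hmult H v (\<rho> (\<one>\<^bsub>K\<^esub>, inv\<^bsub>L\<^esub> b) (proj x)) =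
        (\<Sum>j\<in>carrier K. scale c (hmult H v (\<rho> (inv\<^bsub>S\<^esub> (j, b)) x)))"
      using act by (simp add: act_proj_inv[OF xV b] linear_on_scale[OF mult_linear_right[OF vV]]
          linear_on_sum[OF mult_linear_right[OF vV] space_subspace]
          subspace_scale[OF space_subspace] scale_sum_right)
  qed
  \<comment> \<open>After the interchange \<open>k\<close> can serve as the averaging variable and
    \<open>j\<close> as the block index in the second use of \<open>trace_W\<close>.\<close>
  also have "\<dots> = (\<Sum>k\<in>carrier K. \<Sum>j\<in>carrier K.
      trace_on (gcomp H (k, a)) (\<lambda>x. hmult H (?u k j) (\<rho> (inv\<^bsub>S\<^esub> (j, b)) x)))"
    by (rule sum.swap)
  also have "\<dots> = (\<Sum>k\<in>carrier K. \<Sum>j\<in>carrier K.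
      trace_on (gcomp H (j, b)) (\<lambda>x. \<rho> (k, a) (hmult H (?u k j) x)))"
  proof (intro sum.cong refl trace_axiom)
    fix k j assume kj: "k \<in> carrier K" "j \<in> carrier K"
    show "(k, a) \<in> carrier S" "(j, b) \<in> carrier S" using kj a b by auto
    have "?u k j \<in> gcomp H (fst (w k j), m)"
      using u(1) w(1)[OF kj] m by (intro subspace_scale gcomp_subspace) auto
    then show "?u k j \<in> gcomp H ((k, a) \<otimes>\<^bsub>S\<^esub> (j, b) \<otimes>\<^bsub>S\<^esub> inv\<^bsub>S\<^esub> (k, a) \<otimes>\<^bsub>S\<^esub> inv\<^bsub>S\<^esub> (j, b))"
      using w(2)[OF kj] unfolding w_def by metis
  qed
  \<comment> \<open>The expansion is run backwards for \<open>b\<close>: \<open>proj_act\<close>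
    collects the actions of \<open>(k, a)\<close> into one average taken after multiplication by
    \<open>v\<close>.\<close>
  also have "\<dots> = trace_on (W b) (\<lambda>x. proj (\<rho> (\<one>\<^bsub>K\<^esub>, a) (hmult H v x)))"
  proof (rule trace_W[symmetric, OF b finite_K])
    fix k assume k: "k \<in> carrier K"
    let ?g = "\<lambda>x. scale c (\<rho> (k, a) (hmult H v x))"
    have ka: "(k, a) \<in> carrier S" using k a by simp
    show "linear_on V ?g"
      by (intro linear_on_scaled linear_on_compose[OF mult_linear_right[OF vV] action_linear[OF ka]]
          mult_closed[OF vV])
    {
      fix x assume x: "x \<in> W b"
      have "\<rho> (k, a) (hmult H v x) \<in> W b"
        using action_W[OF k L.m_closed[OF m b] a mult_W[OF m b vW x]] mb by simp
      then show "?g x \<in> W b" by (intro subspace_scale subspace_span)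
    }
    fix j x assume j: "j \<in> carrier K" and x: "x \<in> gcomp H (j, b)"
    let ?t = "\<lambda>i. scale c (\<rho> (k, a) (hmult H (u i) x))"
    let ?q = "\<lambda>i. inv\<^bsub>S\<^esub> (k, a) \<otimes>\<^bsub>S\<^esub> ((i, m) \<otimes>\<^bsub>S\<^esub> (j, b)) \<otimes>\<^bsub>S\<^esub> (k, a)"
    have jb: "(j, b) \<in> carrier S" using j b by simp
    have xV: "x \<in> V" using x gcomp_subset[OF jb] by auto
    show "\<exists>i0\<in>carrier K. \<exists>t e. ?g x = (\<Sum>i\<in>carrier K. t i) \<and>
        \<rho> (k, a) (hmult H (?u k j) x) = t i0 \<and>
        (\<forall>i\<in>carrier K. e i \<in> carrier K \<and> t i \<in> gcomp H (e i, b) \<and> (e i = j \<longleftrightarrow> i = i0))"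
    proof (rule bexI[OF _ w(1)[OF k j]], rule exI[of _ ?t], rule exI[of _ "\<lambda>i. fst (?q i)"],
        intro conjI ballI)
      have "\<rho> (k, a) (\<Sum>i\<in>carrier K. hmult H (u i) x) = (\<Sum>i\<in>carrier K. \<rho> (k, a) (hmult H (u i) x))"
        by (rule linear_on_sum[OF action_linear[OF ka] space_subspace]) (rule mult_closed[OF uV xV])
      then show "?g x = (\<Sum>i\<in>carrier K. ?t i)"
        by (simp add: v_mult[OF xV] scale_sum_right)
      have u0: "u (fst (w k j)) \<in> V" by (rule uV[OF w(1)[OF k j]])
      show "\<rho> (k, a) (hmult H (?u k j) x) = ?t (fst (w k j))"
        using linear_on_scale[OF action_linear[OF ka] mult_closed[OF u0 xV], of c]
        by (simp add: mul_scale[OF u0 xV])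
      fix i assume i: "i \<in> carrier K"
      have im: "(i, m) \<in> carrier S" using i m by simp
      have q: "?q i \<in> carrier S" by (intro m_closed inv_closed im jb ka)
      then show "fst (?q i) \<in> carrier K" by auto
      have "snd (?q i) = b"
        using mb ka by (simp add: snd_mult_S snd_inv_S del: mult_S carrier_S)
      then have eq: "?q i = (fst (?q i), b)" by (metis prod.collapse)
      have "?t i \<in> gcomp H (?q i)"
        by (intro subspace_scale gcomp_subspace[OF q] action_grading[OF ka] m_closed im jb
            mult_grading[OF im jb u(1)[OF i] x])
      then show "?t i \<in> gcomp H (fst (?q i), b)" using eq by metis
      have "fst (?q i) = j \<longleftrightarrow> ?q i = (j, b)" using eq by (metis fst_conv)
      also have "\<dots> \<longleftrightarrow> (i, m) = w k j"
        unfolding w_def by (rule conj_mult_eq_iff[OF im ka jb])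
      also have "\<dots> \<longleftrightarrow> i = fst (w k j)" using w(2)[OF k j] by (metis fst_conv)
      finally show "fst (?q i) = j \<longleftrightarrow> i = fst (w k j)" .
    qed
  next
    fix x assume x: "x \<in> W b"
    then have "hmult H v x \<in> V" using W_subset[OF b] by (intro mult_closed vV) auto
    then show "proj (\<rho> (\<one>\<^bsub>K\<^esub>, a) (hmult H v x)) = (\<Sum>k\<in>carrier K. scale c (\<rho> (k, a) (hmult H v x)))"
      by (simp add: proj_act[OF _ a] scale_sum_right)
  qed
  also have "\<dots> = trace_on (proj ` W b) (\<lambda>x. proj (\<rho> (\<one>\<^bsub>K\<^esub>, a) (hmult H v x)))"
  proof (rule trace_K_inv[symmetric, OF b])
    have "linear_on V (\<lambda>x. \<rho> (\<one>\<^bsub>K\<^esub>, a) (hmult H v x))"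
      using a by (intro linear_on_compose[OF mult_linear_right[OF vV]] action_linear mult_closed[OF vV]) auto
    then show "linear_on V (\<lambda>x. proj (\<rho> (\<one>\<^bsub>K\<^esub>, a) (hmult H v x)))"
      by (rule linear_on_compose[OF _ linear_on_proj])
        (use a in \<open>auto intro!: action_closed mult_closed[OF vV]\<close>)
    fix x assume x: "x \<in> W b"
    have "\<rho> (\<one>\<^bsub>K\<^esub>, a) (hmult H v x) \<in> W b"
      using action_W[OF K.one_closed L.m_closed[OF m b] a mult_W[OF m b vW x]] mb by simp
    then show "proj (\<rho> (\<one>\<^bsub>K\<^esub>, a) (hmult H v x)) \<in> proj ` W b" by (rule imageI)
  qed
  \<comment> \<open>For fixed \<open>x\<close> the product with the fixed \<open>v\<close> is fixed,
    and so is its image under \<open>a\<close>; the outer \<open>proj\<close> drops out.\<close>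
  also have "\<dots> = trace_on (proj ` W b) (\<lambda>x. \<rho> (\<one>\<^bsub>K\<^esub>, a) (hmult H v x))"
  proof (rule trace_on_cong[OF C(1) sub(2,1)[OF b]])
    fix x assume "x \<in> proj ` W b"
    then have x: "x \<in> V" "K_inv x" using proj_W[OF b] W_subset[OF b] by blast+
    have "K_inv (\<rho> (\<one>\<^bsub>K\<^esub>, a) (hmult H v x))"
      using v(2) vV x a by (intro K_inv_act K_inv_mult mult_closed) auto
    then show "proj (\<rho> (\<one>\<^bsub>K\<^esub>, a) (hmult H v x)) = \<rho> (\<one>\<^bsub>K\<^esub>, a) (hmult H v x)"
      by (rule proj_K_inv)
  qed
  finally show ?thesis .
qed

section \<open>Assembling the Frobenius algebra on the coinvariants\<close>

lemma coinvariants_frobenius: "frobenius_algebra scale L d (coinvariants scale K L H)"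
proof -
  let ?C = "coinvariants scale K L H"
  have sel [simp]: "hspace ?C = proj ` V" "gcomp ?C = (\<lambda>l. proj ` W l)"
    "qcomp ?C = (\<lambda>r. proj ` qcomp H r)" "gact ?C = (\<lambda>l. \<rho> (\<one>\<^bsub>K\<^esub>, l))"
    "hmult ?C = hmult H" "hone ?C = hone H" "metric ?C = metric H"
    by (simp_all add: coinvariants_def)
  have sub: "proj ` V \<subseteq> V" by (auto simp: proj_V)
  have V: "v \<in> V" if "v \<in> proj ` V" for v using that sub by auto
  have W: "proj ` W l \<subseteq> V" if "l \<in> carrier L" for l using that W_subset by (auto simp: proj_W)
  have C_sub: "subspace (proj ` V)" by (rule internal_direct_sum_space[OF K_inv_V_sum])
  show ?thesis
  proof (unfold_locales, unfold sel)
    show "finite (carrier L)" by (rule finite_L)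
    show "subspace (proj ` V)" by (rule C_sub)
    show "\<exists>B. finite B \<and> span B = proj ` V"
    proof -
      obtain C where C: "finite C" "span C = V" by (rule finite_dim_V)
      then obtain B where "finite B" "independent B" "span B = proj ` V"
        using trace_on_basis[OF C(1) _ C_sub] sub by metis
      then show ?thesis by blast
    qed
    show "internal_direct_sum (proj ` V) (carrier L) (\<lambda>l. proj ` W l)" by (rule K_inv_V_sum)
    show "internal_direct_sum (proj ` V) UNIV (\<lambda>r. proj ` qcomp H r)" by (rule K_inv_rat_sum)
    show "internal_direct_sum (proj ` W l) UNIV (\<lambda>r. proj ` W l \<inter> proj ` qcomp H r)"
      if "l \<in> carrier L" for l using that by (rule K_inv_W_rat_sum)
    show "linear_on (proj ` V) (\<rho> (\<one>\<^bsub>K\<^esub>, l))" if "l \<in> carrier L" for l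
      using that by (intro linear_on_subset[OF action_linear sub]) simp
    show "\<rho> (\<one>\<^bsub>K\<^esub>, \<one>\<^bsub>L\<^esub>) v = v" if "v \<in> proj ` V" for v
      using action_one V[OF that] by simp
    show "\<rho> (\<one>\<^bsub>K\<^esub>, l \<otimes>\<^bsub>L\<^esub> l') v = \<rho> (\<one>\<^bsub>K\<^esub>, l') (\<rho> (\<one>\<^bsub>K\<^esub>, l) v)"
      if "l \<in> carrier L" "l' \<in> carrier L" "v \<in> proj ` V" for l l' v
      using action_mult[of "(\<one>\<^bsub>K\<^esub>, l)" "(\<one>\<^bsub>K\<^esub>, l')" v] that V by (simp add: act_unit)
    show "\<rho> (\<one>\<^bsub>K\<^esub>, l) v \<in> proj ` V" if "l \<in> carrier L" "v \<in> proj ` V" for l v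
      using that K_inv_act[of v l] action_closed[of "(\<one>\<^bsub>K\<^esub>, l)" v] by (simp add: proj_V)
    show "\<rho> (\<one>\<^bsub>K\<^esub>, l) v \<in> proj ` W (inv\<^bsub>L\<^esub> l \<otimes>\<^bsub>L\<^esub> m \<otimes>\<^bsub>L\<^esub> l)"
      if "l \<in> carrier L" "m \<in> carrier L" "v \<in> proj ` W m" for l m v
      using that K_inv_act[of v l] action_W[of "\<one>\<^bsub>K\<^esub>" m l v] W_subset[of m] by (auto simp: proj_W)
    show "\<rho> (\<one>\<^bsub>K\<^esub>, l) v = v" if "l \<in> carrier L" "v \<in> proj ` W l" for l v
      using that self_invariant_proj[of l v] by (simp add: proj_W)
    show "metric H (u + v) w = metric H u w + metric H v w"
      if "u \<in> proj ` V" "v \<in> proj ` V" "w \<in> proj ` V" for u v w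
      using that V by (simp add: metric_add)
    show "metric H (scale r v) w = r * metric H v w" if "v \<in> proj ` V" "w \<in> proj ` V" for r v w
      using that V by (simp add: metric_scale)
    show "metric H v w = metric H w v" if "v \<in> proj ` V" "w \<in> proj ` V" for v w
      using that V by (simp add: metric_sym)
    show "v = 0" if v: "v \<in> proj ` V" and null: "\<forall>w\<in>proj ` V. metric H v w = 0" for v
    proof (rule metric_nondegenerate[OF V[OF v]], rule ballI)
      fix w assume w: "w \<in> V"
      \<comment> \<open>Pairing the fixed vector \<open>v\<close> with \<open>w\<close> is the same
        as pairing it with \<open>proj w\<close>, so orthogonality to all fixed vectors implies
        orthogonality to all of \<open>V\<close>.\<close>
      have "metric H (proj w) v = 0"
        using null metric_sym[OF V[OF v] V] w by simp
      then show "metric H v w = 0"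
        using metric_proj[OF w V[OF v]] v metric_sym[OF w V[OF v]] by (simp add: proj_V)
    qed
    show "m \<otimes>\<^bsub>L\<^esub> n = \<one>\<^bsub>L\<^esub>"
      if "m \<in> carrier L" "n \<in> carrier L" "v \<in> proj ` W m" "w \<in> proj ` W n" "metric H v w \<noteq> 0" for m n v w
      using that metric_W[of m n v w] by (simp add: proj_W)
    show "hmult H v w \<in> proj ` V" if "v \<in> proj ` V" "w \<in> proj ` V" for v w
      using that K_inv_mult[of v w] mult_closed by (simp add: proj_V)
    show "linear_on (proj ` V) (\<lambda>v. hmult H v w)" if "w \<in> proj ` V" for w
      by (rule linear_on_subset[OF mult_linear_left[OF V[OF that]] sub])
    show "linear_on (proj ` V) (\<lambda>w. hmult H v w)" if "v \<in> proj ` V" for v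
      by (rule linear_on_subset[OF mult_linear_right[OF V[OF that]] sub])
    show "hmult H v w \<in> proj ` W (m \<otimes>\<^bsub>L\<^esub> n)"
      if "m \<in> carrier L" "n \<in> carrier L" "v \<in> proj ` W m" "w \<in> proj ` W n" for m n v w
      using that K_inv_mult[of v w] mult_W[of m n v w] W_subset[of m] W_subset[of n]
      by (auto simp: proj_W)
    show "hmult H (hmult H u v) w = hmult H u (hmult H v w)"
      if "u \<in> proj ` V" "v \<in> proj ` V" "w \<in> proj ` V" for u v w
      using that V by (simp add: mult_assoc)
    show "hmult H v w = hmult H (\<rho> (\<one>\<^bsub>K\<^esub>, inv\<^bsub>L\<^esub> m) w) v"
      if "m \<in> carrier L" "n \<in> carrier L" "v \<in> proj ` W m" "w \<in> proj ` W n" for m n v w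
      using that twisted_comm[of m n v w] by (simp add: proj_W)
    show "hmult H (\<rho> (\<one>\<^bsub>K\<^esub>, l) v) (\<rho> (\<one>\<^bsub>K\<^esub>, l) w) = \<rho> (\<one>\<^bsub>K\<^esub>, l) (hmult H v w)"
      if "l \<in> carrier L" "v \<in> proj ` V" "w \<in> proj ` V" for l v w
      using that V by (simp add: mult_equivariant)
    show "metric H (\<rho> (\<one>\<^bsub>K\<^esub>, l) v) (\<rho> (\<one>\<^bsub>K\<^esub>, l) w) = metric H v w"
      if "l \<in> carrier L" "v \<in> proj ` V" "w \<in> proj ` V" for l v w
      using that V by (simp add: metric_invariant)
    show "metric H (hmult H u v) w = metric H u (hmult H v w)"
      if "u \<in> proj ` V" "v \<in> proj ` V" "w \<in> proj ` V" for u v w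
      using that V by (simp add: metric_mult)
    show "hone H \<in> proj ` W \<one>\<^bsub>L\<^esub>"
      using one_grading one_invariant gcomp_W[of "hone H" "\<one>\<^bsub>K\<^esub>" "\<one>\<^bsub>L\<^esub>"] by (simp add: proj_W)
    show "hmult H (hone H) v = v" if "v \<in> proj ` V" for v
      using that V by (simp add: one_left)
    show "hmult H v (hone H) = v" if "v \<in> proj ` V" for v
      using that V by (simp add: one_right)
    show "\<rho> (\<one>\<^bsub>K\<^esub>, l) (hone H) = hone H" if "l \<in> carrier L" for l
      using that by (simp add: one_invariant)
    show "trace_on (proj ` W a) (\<lambda>x. hmult H v (\<rho> (\<one>\<^bsub>K\<^esub>, inv\<^bsub>L\<^esub> b) x)) =
        trace_on (proj ` W b) (\<lambda>x. \<rho> (\<one>\<^bsub>K\<^esub>, a) (hmult H v x))"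
      if "a \<in> carrier L" "b \<in> carrier L"
        "v \<in> proj ` W (a \<otimes>\<^bsub>L\<^esub> b \<otimes>\<^bsub>L\<^esub> inv\<^bsub>L\<^esub> a \<otimes>\<^bsub>L\<^esub> inv\<^bsub>L\<^esub> b)" for a b v
      using that trace_axiom_K_inv[of a b v] by (simp add: proj_W)
    show "proj ` qcomp H r = {0}" if "r < 0 \<or> r > 2 * of_nat d" for r
      using rat_grading_bounds[OF that] linear_on_zero[OF linear_on_proj space_subspace] by simp
    show "\<rho> (\<one>\<^bsub>K\<^esub>, l) v \<in> proj ` qcomp H r" if "l \<in> carrier L" "v \<in> proj ` qcomp H r" for l v r
      using that K_inv_act[of v l] rat_grading_action[of "(\<one>\<^bsub>K\<^esub>, l)" v r] qcomp_subset[of r]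
      by (auto simp: proj_qcomp)
    show "hmult H v w \<in> proj ` qcomp H (r + s)"
      if "v \<in> proj ` qcomp H r" "w \<in> proj ` qcomp H s" for v w r s
      using that K_inv_mult[of v w] rat_grading_mult[of v r w s] qcomp_subset[of r] qcomp_subset[of s]
      by (auto simp: proj_qcomp)
    show "r + s = 2 * of_nat d"
      if "v \<in> proj ` qcomp H r" "w \<in> proj ` qcomp H s" "metric H v w \<noteq> 0" for v w r s
      using that rat_grading_metric[of v r w s] by (simp add: proj_qcomp)
  qed
qed

end

theorem theorem2p6:
  fixes K :: "('k, 'm) monoid_scheme"
    and L :: "('l, 'n) monoid_scheme"
    and \<alpha> :: "'l \<Rightarrow> 'k \<Rightarrow> 'k"
    and scale :: "rat \<Rightarrow> 'v::ab_group_add \<Rightarrow> 'v"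
    and d :: nat
    and H :: "('k \<times> 'l, 'v) frob_data"
  assumes "group K" and "finite (carrier K)"
    and "group L" and "finite (carrier L)"
    and "right_aut_action K L \<alpha>"
    and "frobenius_algebra scale (semidirect K L \<alpha>) d H"
  shows "frobenius_algebra scale L d (coinvariants scale K L H)"
proof -
  interpret right_aut_action K L \<alpha> by fact
  interpret frobenius_algebra scale "semidirect K L \<alpha>" d H by fact
  interpret semidirect_frobenius K L \<alpha> scale d H ..
  show ?thesis by (rule coinvariants_frobenius)
qed

end
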